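(* In the noncommutative two-torus $A_\theta$ with generators $U,V$, let $f=2(V+V^{-1})$ and equip $\mathcal X_\theta$ with the metric $g=\begin{pmatrix}e^f&0\\0&1\end{pmatrix}$. The associated scalar curvature, $R=-\partial_2^2f-\tfrac12(\partial_2f)^2$, satisfies the Gauss–Bonnet theorem: $\tau(R\sqrt{\det g})=\tau(Re^{f/2})=0$.
   Context: Let $\theta\in\mathbb R$. $A_\theta$ is the universal unital $C^*$-algebra generated by unitaries $U,V$ with $UV=e^{2\pi i\theta}VU$; $A_\theta^\infty=\{\sum_{m,n}a_{mn}U^mV^n:(a_{mn})\text{ rapidly decreasing}\}$; $\tau(\sum a_{mn}U^mV^n)=a_{00}$ is the canonical trace. The canonical derivations are determined by $\partial_1U=cU$, $\partial_1V=0$, $\partial_2U=0$, $\partial_2V=cV$, with normalization constant $c=1$ (in the computation concerning this result; $c=2\pi i$ in the paper's general definition). $\mathcal X_\theta$ is the free left $A_\theta^\infty$-module with basis also denoted $\partial_1,\partial_2$, equipped with the $A_\theta^\infty$-valued inner product with $\langle\partial_i,\partial_j\rangle=g_{ij}$. The scalar curvature of the metric $\mathrm{diag}(e^f,1)$ is $R=e^{-f}(R_{1212}+R_{2121})$, where $R_{ijkl}=\langle(\nabla_j\nabla_i-\nabla_i\nabla_j)\partial_k,\partial_l\rangle$ for the Levi-Civita connection $\nabla_i(aX)=\partial_i(a)X+a\nabla_iX$, $\langle\nabla_i\partial_j,\partial_k\rangle=\frac12\{\partial_ig_{jk}+\partial_jg_{ik}-\partial_kg_{ij}\}$; when $f$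 commutes with $\partial_1f,\partial_2f$ it equals $-\partial_2^2f-\frac12(\partial_2f)^2$. *)

theory Defs
  imports "HOL-Analysis.Analysis" "HOL-Algebra.Module"
begin

section \<open>Unital complex C*-algebras\<close>

class scaleC = scaleR +
  fixes scaleC :: "complex \<Rightarrow> 'a \<Rightarrow> 'a"  (infixr \<open>*\<^sub>C\<close> 75)

class adjoint =
  fixes adj :: "'a \<Rightarrow> 'a"

text \<open>The norm being 1 at the unit (from \<^class>\<open>real_normed_algebra_1\<close>) excludes the zero algebra.\<close>

class cstar_algebra = real_normed_algebra_1 + banach + scaleC + adjoint +
  assumes scaleC_add_right: "c *\<^sub>C (x + y) = c *\<^sub>C x + c *\<^sub>C y"
    and scaleC_add_left: "(c + d) *\<^sub>C x = c *\<^sub>C x + d *\<^sub>C x"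
    and scaleC_scaleC: "c *\<^sub>C (d *\<^sub>C x) = (c * d) *\<^sub>C x"
    and scaleC_one: "1 *\<^sub>C x = x"
    and scaleC_of_real: "complex_of_real r *\<^sub>C x = r *\<^sub>R x"
    and scaleC_mult_left: "(c *\<^sub>C x) * y = c *\<^sub>C (x * y)"
    and scaleC_mult_right: "x * (c *\<^sub>C y) = c *\<^sub>C (x * y)"
    and norm_scaleC: "norm (c *\<^sub>C x) = cmod c * norm x"
    and adj_adj: "adj (adj x) = x"
    and adj_add: "adj (x + y) = adj x + adj y"
    and adj_mult: "adj (x * y) = adj y * adj x"
    and adj_scaleC: "adj (c *\<^sub>C x) = cnj c *\<^sub>C adj x"
    and cstar_identity: "norm (adj x * x) = (norm x)\<^sup>2"

text \<open>
  The universal property below quantifies over all C*-algebras, and a formula cannot quantify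
  over types. The competing algebras are therefore C*-algebras on an explicit carrier.
\<close>

definition complex_ring :: "complex ring" where
  "complex_ring = \<lparr>carrier = UNIV, mult = (*), one = 1, zero = 0, add = (+)\<rparr>"

record 'b cstar = "(complex, 'b) module" +
  star :: "'b \<Rightarrow> 'b"
  nrm :: "'b \<Rightarrow> real"

locale cstar_algebra_on = B?: ring B + Module.module complex_ring B
  for B :: "('b, 'm) cstar_scheme" (structure) +
  assumes one_not_zero: "\<one> \<noteq> \<zero>"
    and smult_mult_left: "\<lbrakk>x \<in> carrier B; y \<in> carrier B\<rbrakk> \<Longrightarrow> (c \<odot>\<^bsub>B\<^esub> x) \<otimes> y = c \<odot>\<^bsub>B\<^esub> (x \<otimes> y)"
    and smult_mult_right: "\<lbrakk>x \<in> carrier B; y \<in> carrier B\<rbrakk> \<Longrightarrow> x \<otimes> (c \<odot>\<^bsub>B\<^esub> y) = c \<odot>\<^bsub>B\<^esub> (x \<otimes> y)"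
    and star_closed: "x \<in> carrier B \<Longrightarrow> star B x \<in> carrier B"
    and star_star: "x \<in> carrier B \<Longrightarrow> star B (star B x) = x"
    and star_add: "\<lbrakk>x \<in> carrier B; y \<in> carrier B\<rbrakk> \<Longrightarrow> star B (x \<oplus> y) = star B x \<oplus> star B y"
    and star_mult: "\<lbrakk>x \<in> carrier B; y \<in> carrier B\<rbrakk> \<Longrightarrow> star B (x \<otimes> y) = star B y \<otimes> star B x"
    and star_smult: "x \<in> carrier B \<Longrightarrow> star B (c \<odot>\<^bsub>B\<^esub> x) = cnj c \<odot>\<^bsub>B\<^esub> star B x"
    and nrm_nonneg: "x \<in> carrier B \<Longrightarrow> 0 \<le> nrm B x"
    and nrm_eq_0: "x \<in> carrier B \<Longrightarrow> nrm B x = 0 \<longleftrightarrow> x = \<zero>"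
    and nrm_triangle: "\<lbrakk>x \<in> carrier B; y \<in> carrier B\<rbrakk> \<Longrightarrow> nrm B (x \<oplus> y) \<le> nrm B x + nrm B y"
    and nrm_smult: "x \<in> carrier B \<Longrightarrow> nrm B (c \<odot>\<^bsub>B\<^esub> x) = cmod c * nrm B x"
    and nrm_mult: "\<lbrakk>x \<in> carrier B; y \<in> carrier B\<rbrakk> \<Longrightarrow> nrm B (x \<otimes> y) \<le> nrm B x * nrm B y"
    and nrm_cstar: "x \<in> carrier B \<Longrightarrow> nrm B (star B x \<otimes> x) = (nrm B x)\<^sup>2"
    and complete: "Metric_space.mcomplete (carrier B) (\<lambda>x y. nrm B (x \<ominus> y))"

definition star_hom :: "('a::cstar_algebra \<Rightarrow> 'b) \<Rightarrow> ('b, 'm) cstar_scheme \<Rightarrow> bool" where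
  "star_hom \<phi> B \<longleftrightarrow>
     (\<forall>x. \<phi> x \<in> carrier B) \<and>
     (\<forall>x y. \<phi> (x + y) = \<phi> x \<oplus>\<^bsub>B\<^esub> \<phi> y) \<and>
     (\<forall>x y. \<phi> (x * y) = \<phi> x \<otimes>\<^bsub>B\<^esub> \<phi> y) \<and>
     \<phi> 1 = \<one>\<^bsub>B\<^esub> \<and>
     (\<forall>c x. \<phi> (c *\<^sub>C x) = c \<odot>\<^bsub>B\<^esub> \<phi> x) \<and>
     (\<forall>x. \<phi> (adj x) = star B (\<phi> x))"

section \<open>The noncommutative two-torus\<close>

definition unitary :: "'a::cstar_algebra \<Rightarrow> bool" where
  "unitary u \<longleftrightarrow> adj u * u = 1 \<and> u * adj u = 1"

definition unitary_on :: "('b, 'm) cstar_scheme \<Rightarrow> 'b \<Rightarrow> bool" where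
  "unitary_on B u \<longleftrightarrow> u \<in> carrier B \<and> star B u \<otimes>\<^bsub>B\<^esub> u = \<one>\<^bsub>B\<^esub> \<and> u \<otimes>\<^bsub>B\<^esub> star B u = \<one>\<^bsub>B\<^esub>"

definition cstar_generated_by :: "'a::cstar_algebra set \<Rightarrow> bool" where
  "cstar_generated_by G \<longleftrightarrow>
     (\<forall>S. G \<subseteq> S \<and> closed S \<and> 1 \<in> S \<and>
          (\<forall>x\<in>S. \<forall>y\<in>S. x + y \<in> S \<and> x * y \<in> S) \<and>
          (\<forall>c. \<forall>x\<in>S. c *\<^sub>C x \<in> S) \<and> (\<forall>x\<in>S. adj x \<in> S)
        \<longrightarrow> S = UNIV)"

text \<open>
  The algebra \<open>'a\<close> with \<open>U\<close>, \<open>V\<close> is \<open>A\<^sub>\<theta>\<close>. Letting the carrier of \<open>B\<close> range over subsets of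
  \<open>'a\<close> loses no generality: only the C*-subalgebra of \<open>B\<close> generated by \<open>u\<close> and \<open>v\<close> matters, it
  has the cardinality of the continuum, and \<open>'a\<close> has at least that cardinality since it
  contains the multiples of the unit. So every pair of such unitaries occurs up to isomorphism.
\<close>

definition noncommutative_torus :: "real \<Rightarrow> 'a::cstar_algebra \<Rightarrow> 'a \<Rightarrow> bool" where
  "noncommutative_torus \<theta> U V \<longleftrightarrow>
     unitary U \<and> unitary V \<and> U * V = exp (2 * of_real pi * \<i> * of_real \<theta>) *\<^sub>C (V * U) \<and>
     cstar_generated_by {U, V} \<and>
     (\<forall>(B :: 'a cstar) u v.
        cstar_algebra_on B \<and> unitary_on B u \<and> unitary_on B v \<and>
        u \<otimes>\<^bsub>B\<^esub> v = exp (2 * of_real pi * \<i> * of_real \<theta>) \<odot>\<^bsub>B\<^esub> (v \<otimes>\<^bsub>B\<^esub> u)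
        \<longrightarrow> (\<exists>!\<phi>. star_hom \<phi> B \<and> \<phi> U = u \<and> \<phi> V = v))"

text \<open>Integer powers of a unitary; \<^const>\<open>power_int\<close> requires an inverse operation on the type.\<close>

definition upow :: "'a::cstar_algebra \<Rightarrow> int \<Rightarrow> 'a" where
  "upow u k = (if k \<ge> 0 then u ^ nat k else adj u ^ nat (- k))"

definition rapidly_decreasing :: "(int \<times> int \<Rightarrow> complex) \<Rightarrow> bool" where
  "rapidly_decreasing a \<longleftrightarrow>
     (\<forall>k::nat. \<exists>C. \<forall>m n. (1 + \<bar>real_of_int m\<bar> + \<bar>real_of_int n\<bar>) ^ k * cmod (a (m, n)) \<le> C)"

definition fourier_expansion ::
    "'a::cstar_algebra \<Rightarrow> 'a \<Rightarrow> (int \<times> int \<Rightarrow> complex) \<Rightarrow> 'a \<Rightarrow> bool" where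
  "fourier_expansion U V a x \<longleftrightarrow>
     rapidly_decreasing a \<and>
     ((\<lambda>(m, n). a (m, n) *\<^sub>C (upow U m * upow V n)) has_sum x) UNIV"

definition smooth :: "'a::cstar_algebra \<Rightarrow> 'a \<Rightarrow> 'a set" where
  "smooth U V = {x. \<exists>a. fourier_expansion U V a x}"

definition fourier_coeff :: "'a::cstar_algebra \<Rightarrow> 'a \<Rightarrow> 'a \<Rightarrow> int \<times> int \<Rightarrow> complex" where
  "fourier_coeff U V x = (THE a. fourier_expansion U V a x)"

definition nc_trace :: "'a::cstar_algebra \<Rightarrow> 'a \<Rightarrow> 'a \<Rightarrow> complex" where
  "nc_trace U V x = fourier_coeff U V x (0, 0)"

text \<open>
  The canonical derivations with normalization \<open>c = 1\<close>: the Leibniz rule, \<open>\<partial>\<^sub>1 U = U\<close>,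
  \<open>\<partial>\<^sub>1 V = 0\<close>, \<open>\<partial>\<^sub>2 U = 0\<close> and \<open>\<partial>\<^sub>2 V = V\<close> force \<open>\<partial>\<^sub>1 (U\<^sup>m V\<^sup>n) = m U\<^sup>m V\<^sup>n\<close> and
  \<open>\<partial>\<^sub>2 (U\<^sup>m V\<^sup>n) = n U\<^sup>m V\<^sup>n\<close>, extended termwise to Fourier series. The index type \<open>2\<close> has the
  two elements \<open>1\<close> and \<open>2\<close>.
\<close>

definition deriv_nc :: "'a::cstar_algebra \<Rightarrow> 'a \<Rightarrow> 2 \<Rightarrow> 'a \<Rightarrow> 'a" where
  "deriv_nc U V i x =
     (\<Sum>\<^sub>\<infinity>(m, n). (of_int (if i = 1 then m else n) * fourier_coeff U V x (m, n)) *\<^sub>C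
                  (upow U m * upow V n))"

section \<open>Metrics, the Levi-Civita connection and curvature\<close>

text \<open>An element \<open>X :: 'a ^ 2\<close> stands for \<open>X\<^sub>1 \<partial>\<^sub>1 + X\<^sub>2 \<partial>\<^sub>2\<close>; the left action is \<open>a *s X\<close>.\<close>

definition vector_fields :: "'a::cstar_algebra \<Rightarrow> 'a \<Rightarrow> ('a ^ 2) set" where
  "vector_fields U V = {X. \<forall>i. X $ i \<in> smooth U V}"

definition basis_field :: "2 \<Rightarrow> 'a::cstar_algebra ^ 2" where
  "basis_field i = axis i 1"

definition inner_nc :: "'a::cstar_algebra ^ 2 ^ 2 \<Rightarrow> 'a ^ 2 \<Rightarrow> 'a ^ 2 \<Rightarrow> 'a" where
  "inner_nc g X Y = (\<Sum>i\<in>UNIV. \<Sum>j\<in>UNIV. X $ i * g $ i $ j * adj (Y $ j))"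

text \<open>Only the values of \<open>D i\<close> on \<^const>\<open>vector_fields\<close> matter.\<close>

definition levi_civita ::
    "'a::cstar_algebra \<Rightarrow> 'a \<Rightarrow> 'a ^ 2 ^ 2 \<Rightarrow> (2 \<Rightarrow> 'a ^ 2 \<Rightarrow> 'a ^ 2) \<Rightarrow> bool" where
  "levi_civita U V g D \<longleftrightarrow>
     (\<forall>i. \<forall>X\<in>vector_fields U V. D i X \<in> vector_fields U V) \<and>
     (\<forall>i. \<forall>X\<in>vector_fields U V. \<forall>Y\<in>vector_fields U V. D i (X + Y) = D i X + D i Y) \<and>
     (\<forall>i. \<forall>a\<in>smooth U V. \<forall>X\<in>vector_fields U V.
        D i (a *s X) = deriv_nc U V i a *s X + a *s D i X) \<and>
     (\<forall>i j k. inner_nc g (D i (basis_field j)) (basis_field k) =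
        (1/2) *\<^sub>R (deriv_nc U V i (g $ j $ k) + deriv_nc U V j (g $ i $ k)
                  - deriv_nc U V k (g $ i $ j)))"

definition riemann ::
    "'a::cstar_algebra ^ 2 ^ 2 \<Rightarrow> (2 \<Rightarrow> 'a ^ 2 \<Rightarrow> 'a ^ 2) \<Rightarrow> 2 \<Rightarrow> 2 \<Rightarrow> 2 \<Rightarrow> 2 \<Rightarrow> 'a" where
  "riemann g D i j k l =
     inner_nc g (D j (D i (basis_field k)) - D i (D j (basis_field k))) (basis_field l)"

definition diag_metric :: "'a::cstar_algebra \<Rightarrow> 'a ^ 2 ^ 2" where
  "diag_metric f = (\<chi> i j. if i = j then (if i = 1 then exp f else 1) else 0)"

definition scalar_curvature ::
    "'a::cstar_algebra \<Rightarrow> (2 \<Rightarrow> 'a ^ 2 \<Rightarrow> 'a ^ 2) \<Rightarrow> 'a" where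
  "scalar_curvature f D =
     exp (- f) * (riemann (diag_metric f) D 1 2 1 2 + riemann (diag_metric f) D 2 1 2 1)"

text \<open>
  The determinant in the usual form; it is used only when the entries of \<open>g\<close> commute. The
  library determinant requires a commutative ring.
\<close>

definition det_nc :: "'a::cstar_algebra ^ 2 ^ 2 \<Rightarrow> 'a" where
  "det_nc g = g $ 1 $ 1 * g $ 2 $ 2 - g $ 1 $ 2 * g $ 2 $ 1"

text \<open>The positive elements of a C*-algebra are the squares of self-adjoint elements.\<close>

definition positive :: "'a::cstar_algebra \<Rightarrow> bool" where
  "positive x \<longleftrightarrow> (\<exists>h. adj h = h \<and> x = h * h)"

definition cstar_sqrt :: "'a::cstar_algebra \<Rightarrow> 'a" where
  "cstar_sqrt x = (THE y. positive y \<and> y * y = x)"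

end

theory Submission
  imports Defs "HOL-Library.Real_Mod"
begin

text \<open>
  The curvature density is a total derivative. Since \<open>f\<close>, \<open>\<partial>\<^sub>2 f\<close> and the exponentials of \<open>f\<close> lie in
  the commutative algebra generated by \<open>V\<close>, the classical computation goes through:
  \<open>R = - \<partial>\<^sub>2\<^sup>2 f - (\<partial>\<^sub>2 f)\<^sup>2 / 2\<close>, and by the Leibniz rule \<open>R e\<^bsup>f/2\<^esup> = - \<partial>\<^sub>2 (\<partial>\<^sub>2 f e\<^bsup>f/2\<^esup>)\<close>. A derivation
  multiplies the Fourier coefficient at \<open>(m, n)\<close> by \<open>m\<close> or \<open>n\<close>, so a derivative has trace zero.

  The work lies in the facts that this argument takes for granted.

  The trace and the derivations are defined through Fourier coefficients, which must be shown unique.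
  The universal property, applied to the torus algebra itself, gives for every pair of phases a star
  homomorphism rotating the generators (\<open>ex_gauge_hom\<close>). Star homomorphisms are contractive
  (\<open>star_hom_contractive\<close>), so they act termwise on Fourier series, and averaging over roots of unity
  isolates a single coefficient (\<open>zero_sum_imp_zero_coeff\<close>).

  Smooth elements form an algebra on which the derivations satisfy the Leibniz rule, because Fourier
  series multiply by a twisted convolution (\<open>fourier_expansion_mult\<close>, \<open>deriv_mult\<close>). The exponentials
  of \<open>f\<close> are smooth, being products of exponentials of multiples of \<open>V\<close> and \<open>V\<^sup>*\<close>, whose Fourier
  coefficients are explicit (\<open>fourier_expansion_exp\<close>).

  The volume density is the positive square root of \<open>e\<^sup>f\<close>, which must be shown to be \<open>e\<^bsup>f/2\<^esup>\<close> and
  nothing else (\<open>cstar_sqrt_exp\<close>). Rescaled into the unit ball around 1, \<open>e\<^sup>f\<close> has a square root given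
  by the binomial series, which commutes with everything that commutes with \<open>e\<^sup>f\<close>; this forces every
  positive square root to agree with it (\<open>positive_sqrt_eq_binomial_series\<close>).
\<close>

section \<open>Scalars and adjoints in C*-algebras\<close>

lemma commute_left: "a * b = b * a \<Longrightarrow> a * (b * c) = b * (a * (c::'a::semigroup_mult))"
  by (simp flip: mult.assoc)

lemma scaleC_0_left [simp]: "0 *\<^sub>C (x::'a::cstar_algebra) = 0"
  using scaleC_of_real[of 0 x] by simp

lemma bounded_linear_scaleC_right: "bounded_linear (\<lambda>x::'a::cstar_algebra. c *\<^sub>C x)"
proof (rule bounded_linear_intro[where K = "cmod c"])
  fix r and x :: 'a
  have "c *\<^sub>C (r *\<^sub>R x) = (c * of_real r) *\<^sub>C x"
    by (simp only: scaleC_of_real[symmetric] scaleC_scaleC)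
  also have "\<dots> = r *\<^sub>R (c *\<^sub>C x)"
    by (simp only: scaleC_of_real[symmetric] scaleC_scaleC mult.commute)
  finally show "c *\<^sub>C (r *\<^sub>R x) = r *\<^sub>R (c *\<^sub>C x)" .
qed (auto simp: scaleC_add_right norm_scaleC mult.commute)

lemma scaleC_minus_left: "(- c) *\<^sub>C (x::'a::cstar_algebra) = - (c *\<^sub>C x)"
  by (metis add_eq_0_iff scaleC_add_left scaleC_0_left add.right_inverse)

lemma scaleC_diff_left: "(c - d) *\<^sub>C (x::'a::cstar_algebra) = c *\<^sub>C x - d *\<^sub>C x"
  by (metis scaleC_add_left scaleC_minus_left diff_conv_add_uminus)

lemma scaleC_zero_right [simp]: "c *\<^sub>C (0::'a::cstar_algebra) = 0"
  using norm_scaleC[of c "0::'a"] by simp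

lemma scaleC_minus_right: "c *\<^sub>C (- x::'a::cstar_algebra) = - (c *\<^sub>C x)"
  by (metis add_eq_0_iff scaleC_add_right scaleC_zero_right add.right_inverse)

lemma scaleC_diff_right: "c *\<^sub>C (x - y) = c *\<^sub>C x - c *\<^sub>C (y::'a::cstar_algebra)"
  by (metis scaleC_add_right scaleC_minus_right diff_conv_add_uminus)

lemma scaleR_scaleC: "r *\<^sub>R (c *\<^sub>C x) = (of_real r * c) *\<^sub>C (x::'a::cstar_algebra)"
  by (simp only: scaleC_of_real[symmetric] scaleC_scaleC)

lemma adj_scaleR: "adj (r *\<^sub>R x) = r *\<^sub>R adj (x::'a::cstar_algebra)"
  by (simp only: scaleC_of_real[symmetric] adj_scaleC complex_cnj_complex_of_real)

lemma adj_one [simp]: "adj (1::'a::cstar_algebra) = 1"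
  by (metis adj_adj adj_mult mult_1)

lemma adj_zero [simp]: "adj (0::'a::cstar_algebra) = 0"
  using adj_scaleR[of 0 "0::'a"] by simp

lemma adj_minus: "adj (- x) = - adj (x::'a::cstar_algebra)"
  using adj_scaleR[of "-1" x] by simp

lemma adj_diff: "adj (x - y) = adj x - adj (y::'a::cstar_algebra)"
  by (metis adj_add adj_minus diff_conv_add_uminus)

lemma norm_adj [simp]: "norm (adj x) = norm (x::'a::cstar_algebra)"
proof -
  have le: "norm y \<le> norm (adj y)" for y :: 'a
  proof (cases "y = 0")
    case False
    have "(norm y)\<^sup>2 \<le> norm (adj y) * norm y"
      by (metis cstar_identity norm_mult_ineq)
    with False show ?thesis by (simp add: power2_eq_square)
  qed simp
  from le[of x] le[of "adj x"] show ?thesis by (simp add: adj_adj)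
qed

lemma bounded_linear_adj: "bounded_linear (adj :: 'a::cstar_algebra \<Rightarrow> 'a)"
  by (rule bounded_linear_intro[where K = 1]) (auto simp: adj_add adj_scaleR)

lemma norm_square_selfadjoint:
  "adj x = x \<Longrightarrow> norm (x * x) = (norm (x::'a::cstar_algebra))\<^sup>2"
  by (metis cstar_identity)

lemma adj_power: "adj (x ^ n) = adj (x::'a::cstar_algebra) ^ n"
  by (induction n) (auto simp: adj_mult power_commutes)

lemma adj_exp: "adj (exp x) = exp (adj (x::'a::cstar_algebra))"
proof -
  have "adj (exp x) = (\<Sum>n. adj (x ^ n /\<^sub>R fact n))"
    unfolding exp_def by (rule bounded_linear.suminf[OF bounded_linear_adj summable_exp_generic])
  then show ?thesis by (simp add: exp_def adj_scaleR adj_power)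
qed

lemma commute_exp: "c * z = z * c \<Longrightarrow> c * exp z = exp z * (c::'a::{real_normed_algebra_1,banach})"
  unfolding exp_def
  by (simp add: suminf_mult[symmetric] suminf_mult2 summable_exp_generic power_commuting_commutes)

section \<open>The binomial series\<close>

text \<open>
  The series of \<open>(1 + z)\<^sup>a\<close>. For \<open>norm z < 1\<close> it supplies square roots and fourth roots of
  \<open>1 + z\<close> that commute with everything commuting with \<open>z\<close>; this replaces the continuous
  functional calculus throughout.
\<close>

definition binomial_series :: "real \<Rightarrow> 'a \<Rightarrow> 'a::{real_normed_algebra_1,banach}" where
  "binomial_series a z = (\<Sum>n. (a gchoose n) *\<^sub>R z ^ n)"

lemma summable_norm_binomial_series:
  fixes z :: "'a::{real_normed_algebra_1,banach}"
  assumes "norm z < 1"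
  shows "summable (\<lambda>n. norm ((a gchoose n) *\<^sub>R z ^ n))"
proof -
  obtain r where r: "norm z < r" "r < 1" using assms dense by blast
  then have "0 < r" using norm_ge_zero[of z] by linarith
  then have "summable (\<lambda>n. (a gchoose n) * r ^ n)"
    using gen_binomial_real[of r a] r by (auto simp: sums_iff)
  then have "summable (\<lambda>n. norm ((a gchoose n) * norm z ^ n))"
    by (rule powser_insidea) (use r \<open>0 < r\<close> in auto)
  then show ?thesis
    by (rule summable_comparison_test'[where N = 0])
       (auto simp: abs_mult intro!: mult_left_mono norm_power_ineq)
qed

lemma summable_binomial_series:
  fixes z :: "'a::{real_normed_algebra_1,banach}"
  assumes "norm z < 1"
  shows "summable (\<lambda>n. (a gchoose n) *\<^sub>R z ^ n)"
  using summable_norm_binomial_series[OF assms] by (rule summable_norm_cancel)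

text \<open>
  Cauchy product of the two series; the coefficients match by Vandermonde's identity, taken here
  from the additivity of the formal binomial series.
\<close>

lemma binomial_series_add:
  fixes z :: "'a::{real_normed_algebra_1,banach}"
  assumes "norm z < 1"
  shows "binomial_series (a + b) z = binomial_series a z * binomial_series b z"
proof -
  have *: "(a + b) gchoose k = (\<Sum>i\<le>k. (a gchoose i) * (b gchoose (k - i)))" for k
    using arg_cong[OF fps_binomial_add_mult[of a b], of "\<lambda>F. fps_nth F k"]
    by (simp add: fps_mult_nth atLeast0AtMost)
  have "(\<Sum>i\<le>k. ((a gchoose i) *\<^sub>R z ^ i) * ((b gchoose (k - i)) *\<^sub>R z ^ (k - i)))
      = ((a + b) gchoose k) *\<^sub>R z ^ k" for k
    unfolding * scaleR_sum_left by (rule sum.cong) (auto simp: power_add[symmetric])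
  then show ?thesis
    unfolding binomial_series_def
    by (simp add: Cauchy_product[OF summable_norm_binomial_series[OF assms, of a]
          summable_norm_binomial_series[OF assms, of b]])
qed

lemma binomial_series_0: "binomial_series 0 z = 1"
  unfolding binomial_series_def
  by (subst suminf_finite[of "{0}"]) (auto simp: gbinomial_0_left)

lemma binomial_series_1: "binomial_series 1 z = 1 + z"
  unfolding binomial_series_def
proof (subst suminf_finite[of "{0, 1}"])
  fix n :: nat assume "n \<notin> {0, 1}"
  have "(1::real) gchoose n = of_nat (1 choose n)"
    using binomial_gbinomial[of 1 n, where 'a = real] by (metis of_nat_1)
  also have "1 choose n = 0" using \<open>n \<notin> {0, 1}\<close> by (intro binomial_eq_0) auto
  finally have "(1::real) gchoose n = 0" by simp
  then show "(1 gchoose n) *\<^sub>R z ^ n = 0" by simp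
qed auto

lemma commute_binomial_series:
  fixes z :: "'a::{real_normed_algebra_1,banach}"
  assumes "norm z < 1" "c * z = z * c"
  shows "c * binomial_series a z = binomial_series a z * c"
  unfolding binomial_series_def
  by (simp add: suminf_mult[symmetric] suminf_mult2 summable_binomial_series assms power_commuting_commutes)

lemma adj_binomial_series:
  fixes z :: "'a::cstar_algebra"
  assumes "norm z < 1" "adj z = z"
  shows "adj (binomial_series a z) = binomial_series a z"
proof -
  have "adj (binomial_series a z) = (\<Sum>n. adj ((a gchoose n) *\<^sub>R z ^ n))"
    unfolding binomial_series_def
    by (rule bounded_linear.suminf[OF bounded_linear_adj summable_binomial_series[OF assms(1)]])
  then show ?thesis by (simp add: binomial_series_def adj_scaleR adj_power assms)
qed

section \<open>Star homomorphisms are contractive\<close>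

text \<open>
  The element \<open>a + \<i>b\<close> is unitary, so it has norm 1, and \<open>a\<close> is its real part.
\<close>

lemma norm_le_1_of_sum_squares:
  fixes a b :: "'a::cstar_algebra"
  assumes "adj a = a" "adj b = b" "a * b = b * a" "a * a + b * b = 1"
  shows "norm a \<le> 1"
proof -
  define u where "u = a + \<i> *\<^sub>C b"
  have adju: "adj u = a + (- \<i>) *\<^sub>C b"
    by (simp add: u_def adj_add adj_scaleC assms)
  have "adj u * u = a * a + b * b"
    unfolding adju unfolding u_def
    by (simp add: algebra_simps scaleC_mult_left scaleC_mult_right scaleC_scaleC scaleC_minus_left
        scaleC_one scaleC_diff_right assms(3))
  then have "(norm u)\<^sup>2 = 1" using cstar_identity[of u] assms by simp
  then have u: "norm u = 1" by (simp add: power2_eq_1_iff) (smt (verit) norm_ge_zero)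
  have "u + adj u = 2 *\<^sub>R a"
    unfolding adju unfolding u_def by (simp add: scaleC_minus_left scaleR_2)
  then have "2 * norm a \<le> norm u + norm (adj u)"
    by (metis norm_triangle_ineq norm_scaleR abs_numeral)
  with u show ?thesis by simp
qed

section \<open>Uniqueness of positive square roots\<close>

text \<open>
  If \<open>\<rho> - x\<close> and \<open>\<rho> + x\<close> are commuting squares, then \<open>x\<^sup>2 + (pq)\<^sup>2 = \<rho>\<^sup>2\<close>, and the bound for a sum
  of two squares applies. It is an order-free form of \<open>- \<rho> \<le> x \<le> \<rho>\<close>.
\<close>

lemma norm_le_of_squares:
  fixes x p q :: "'a::cstar_algebra"
  assumes "0 < \<rho>" "adj x = x" "adj p = p" "adj q = q"
    and com: "p * q = q * p" "p * x = x * p" "q * x = x * q"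
    and sq: "\<rho> *\<^sub>R 1 - x = p * p" "\<rho> *\<^sub>R 1 + x = q * q"
  shows "norm x \<le> \<rho>"
proof -
  have "(p * q) * (p * q) = (p * p) * (q * q)"
    by (simp add: mult.assoc commute_left[OF com(1)])
  also have "\<dots> = (\<rho>\<^sup>2) *\<^sub>R 1 - x * x"
    unfolding sq[symmetric] by (simp add: algebra_simps power2_eq_square)
  finally have pq: "(p * q) * (p * q) = (\<rho>\<^sup>2) *\<^sub>R 1 - x * x" .
  have "norm ((1 / \<rho>) *\<^sub>R x) \<le> 1"
  proof (rule norm_le_1_of_sum_squares[where b = "(1 / \<rho>) *\<^sub>R (p * q)"])
    show "(1 / \<rho>) *\<^sub>R x * (1 / \<rho>) *\<^sub>R x + (1 / \<rho>) *\<^sub>R (p * q) * (1 / \<rho>) *\<^sub>R (p * q) = 1"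
      using \<open>0 < \<rho>\<close> by (simp add: pq scaleR_diff_right power2_eq_square)
    show "(1 / \<rho>) *\<^sub>R x * (1 / \<rho>) *\<^sub>R (p * q) = (1 / \<rho>) *\<^sub>R (p * q) * (1 / \<rho>) *\<^sub>R x"
      by (simp add: mult.assoc com commute_left[OF com(2)] commute_left[OF com(3)])
  qed (simp_all add: adj_scaleR adj_mult assms)
  then show ?thesis using \<open>0 < \<rho>\<close> by (simp add: field_simps)
qed

text \<open>
  By the C*-identity it suffices to treat \<open>h = x\<^sup>*x\<close> with \<open>norm h < 1\<close>. The binomial series gives
  a self-adjoint \<open>k\<close> commuting with \<open>h\<close> and satisfying \<open>h\<^sup>2 + k\<^sup>2 = 1\<close>. The homomorphism preserves
  this relation, hence it cannot increase the norm beyond 1. The usual proof through the spectral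
  radius is thereby avoided.
\<close>

lemma star_hom_contractive:
  fixes \<phi> :: "'a::cstar_algebra \<Rightarrow> 'b::cstar_algebra"
  assumes add: "\<And>x y. \<phi> (x + y) = \<phi> x + \<phi> y"
    and mult: "\<And>x y. \<phi> (x * y) = \<phi> x * \<phi> y"
    and one: "\<phi> 1 = 1"
    and scale: "\<And>c x. \<phi> (c *\<^sub>C x) = c *\<^sub>C \<phi> x"
    and adj: "\<And>x. \<phi> (adj x) = adj (\<phi> x)"
  shows "norm (\<phi> x) \<le> norm x"
proof -
  have scaleR: "\<phi> (r *\<^sub>R x) = r *\<^sub>R \<phi> x" for r x
    by (simp only: scaleC_of_real[symmetric] scale)
  have unit_ball: "norm (\<phi> x) \<le> 1" if x: "norm x < 1" for x
  proof -
    define h where "h = adj x * x"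
    have h: "adj h = h" "norm h < 1"
      using x by (auto simp: h_def adj_mult adj_adj cstar_identity abs_square_less_1)
    have hh: "norm (- (h * h)) < 1" "adj (- (h * h)) = - (h * h)"
      using h by (auto simp: norm_square_selfadjoint abs_square_less_1 adj_minus adj_mult)
    define k where "k = binomial_series (1/2) (- (h * h))"
    have "k * k = 1 - h * h"
      using binomial_series_add[OF hh(1), of "1/2" "1/2"]
      by (simp add: k_def binomial_series_1)
    then have "\<phi> (h * h + k * k) = \<phi> 1" by simp
    then have sum: "\<phi> h * \<phi> h + \<phi> k * \<phi> k = 1" by (simp only: add mult one)
    have "h * k = k * h"
      unfolding k_def by (rule commute_binomial_series[OF hh(1)]) (simp add: mult.assoc)
    then have com: "\<phi> h * \<phi> k = \<phi> k * \<phi> h" by (metis mult)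
    have "adj k = k" unfolding k_def by (rule adj_binomial_series[OF hh])
    then have "norm (\<phi> h) \<le> 1"
      using norm_le_1_of_sum_squares[OF _ _ com sum] h adj by metis
    then have "(norm (\<phi> x))\<^sup>2 \<le> 1"
      by (simp add: h_def mult adj cstar_identity)
    then show ?thesis by (simp add: abs_square_le_1)
  qed
  show ?thesis
  proof (rule dense_ge)
    fix r assume r: "norm x < r"
    then have "0 < r" using norm_ge_zero[of x] by linarith
    have "norm (\<phi> ((1 / r) *\<^sub>R x)) \<le> 1"
      using r \<open>0 < r\<close> by (intro unit_ball) simp
    then show "norm (\<phi> x) \<le> r" using \<open>0 < r\<close> by (simp add: scaleR field_simps)
  qed
qed

text \<open>
  A self-adjoint element has real spectrum, in the form that \<open>x + \<i>\<close> has trivial kernel for left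
  multiplication. For a real parameter \<open>t\<close>, the equation \<open>x d = - \<i> d\<close> gives \<open>(x - \<i>t) d = - \<i>(1 + t) d\<close>, while the
  C*-identity bounds \<open>(norm (x - \<i>t))\<^sup>2\<close> by \<open>(norm x)\<^sup>2 + t\<^sup>2\<close>. For \<open>t = (norm x)\<^sup>2\<close> this is less than
  \<open>(1 + t)\<^sup>2\<close>, so \<open>d = 0\<close>.
\<close>

lemma selfadjoint_add_i_injective:
  fixes x d :: "'a::cstar_algebra"
  assumes x: "adj x = x" and d: "x * d + \<i> *\<^sub>C d = 0"
  shows "d = 0"
proof (rule ccontr)
  assume "d \<noteq> 0"
  define t where "t = (norm x)\<^sup>2"
  define y where "y = x + (- \<i> * of_real t) *\<^sub>C 1"
  have adjy: "adj y = x + (\<i> * of_real t) *\<^sub>C 1"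
    by (simp add: y_def adj_add adj_scaleC x)
  have "adj y * y = x * x + (t * t) *\<^sub>R 1"
    unfolding adjy unfolding y_def
    by (simp add: algebra_simps scaleC_mult_left scaleC_mult_right scaleC_scaleC scaleC_minus_left
        scaleC_add_right flip: scaleC_of_real)
  then have "(norm y)\<^sup>2 \<le> norm (x * x) + norm ((t * t) *\<^sub>R (1::'a))"
    using cstar_identity[of y] norm_triangle_ineq[of "x * x"] by metis
  also have "\<dots> = t + t\<^sup>2" using x by (simp add: norm_square_selfadjoint t_def power2_eq_square)
  also have "\<dots> < (1 + t)\<^sup>2" by (simp add: t_def power2_eq_square algebra_simps add_pos_nonneg)
  finally have y: "norm y < 1 + t" by (rule power2_less_imp_less) (simp add: t_def)
  have "y * d = (- \<i> * of_real (1 + t)) *\<^sub>C d"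
    using d by (simp add: y_def algebra_simps scaleC_add_left scaleC_mult_left scaleC_minus_left
        scaleC_diff_left add_eq_0_iff)
  moreover have "cmod (- \<i> * of_real (1 + t)) = 1 + t"
    by (simp only: norm_mult norm_minus_cancel norm_ii norm_of_real) (simp add: t_def)
  ultimately have "(1 + t) * norm d \<le> norm y * norm d"
    using norm_mult_ineq[of y d] by (simp only: norm_scaleC)
  with y \<open>d \<noteq> 0\<close> show False by simp
qed

text \<open>
  Dividing by \<open>c\<^sup>2\<close> reduces the sum to \<open>x\<^sup>2 + 1 = (x + \<i>)(x - \<i>)\<close> with \<open>x = a c\<^sup>-\<^sup>1\<close> self-adjoint, and
  both factors are injective.
\<close>

lemma sum_squares_injective:
  fixes a c d :: "'a::cstar_algebra"
  assumes "adj a = a" "adj c = c" and com: "a * c = c * a" 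
    and inv: "c * c' = 1" "c' * c = 1"
    and d: "(a * a + c * c) * d = 0"
  shows "d = 0"
proof -
  have c': "adj c' = c'"
  proof -
    have "adj c' = adj c' * (c * c')" by (simp add: inv)
    also have "\<dots> = adj (c * c') * c'" by (simp add: adj_mult assms(2) mult.assoc)
    finally show ?thesis unfolding inv by simp
  qed
  have com': "a * c' = c' * a"
  proof -
    have "a * c' = (c' * c) * a * c'" by (simp add: inv)
    also have "\<dots> = c' * a * (c * c')" by (simp add: mult.assoc commute_left[OF com[symmetric]])
    finally show ?thesis by (simp add: inv)
  qed
  define x where "x = a * c'"
  define e where "e = c * (c * d)"
  have x: "adj x = x" "adj (- x) = - x" by (simp_all add: x_def adj_mult adj_minus assms c' com')
  have cancel: "c' * (c * u) = u" for u using inv(2) by (simp flip: mult.assoc)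
  have xx: "x * (x * e) = a * (a * d)"
    unfolding x_def e_def by (simp add: mult.assoc cancel commute_left[OF com'[symmetric]])
  have "x * (x * e) + e = 0" using d unfolding xx unfolding e_def by (simp add: algebra_simps)
  then have "x * (x * e - \<i> *\<^sub>C e) + \<i> *\<^sub>C (x * e - \<i> *\<^sub>C e) = 0"
    by (simp add: algebra_simps scaleC_mult_right scaleC_scaleC scaleC_diff_right
        scaleC_minus_left scaleC_one)
  then have "x * e - \<i> *\<^sub>C e = 0" by (rule selfadjoint_add_i_injective[OF x(1)])
  then have "(- x) * e + \<i> *\<^sub>C e = 0" by simp
  then have "e = 0" by (rule selfadjoint_add_i_injective[OF x(2)])
  then show "d = 0" unfolding e_def by (metis cancel mult_zero_right)
qed

text \<open>
  Write \<open>y = h\<^sup>2\<close> and \<open>S = T\<^sup>2\<close> for the binomial square root \<open>S\<close> and fourth root \<open>T\<close>. Since \<open>h\<close> commutes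
  with \<open>h\<^sup>4 = 1 + z\<close>, it commutes with \<open>T\<close>, so \<open>(h\<^sup>2 + T\<^sup>2)(y - S) = y\<^sup>2 - S\<^sup>2 = 0\<close>, and the first factor is
  injective because \<open>T\<close> is invertible.
\<close>

lemma positive_sqrt_eq_binomial_series:
  fixes y z :: "'a::cstar_algebra"
  assumes z: "norm z < 1" "adj z = z" and y: "positive y" "y * y = 1 + z"
  shows "y = binomial_series (1/2) z"
proof -
  obtain h where h: "adj h = h" "y = h * h" using y(1) by (auto simp: positive_def)
  define T where "T = binomial_series (1/4) z"
  define T' where "T' = binomial_series (-1/4) z"
  define S where "S = binomial_series (1/2) z"
  have S: "S = T * T" using binomial_series_add[OF z(1), of "1/4" "1/4"] by (simp add: S_def T_def)
  have SS: "S * S = 1 + z"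
    using binomial_series_add[OF z(1), of "1/2" "1/2"] by (simp add: S_def binomial_series_1)
  have inv: "T * T' = 1" "T' * T = 1"
    using binomial_series_add[OF z(1), of "1/4" "-1/4"] binomial_series_add[OF z(1), of "-1/4" "1/4"]
    by (simp_all add: T_def T'_def binomial_series_0)
  have zh: "z = h * (h * (h * h)) - 1" using y h by (simp add: mult.assoc)
  have "h * z = z * h" unfolding zh by (simp add: algebra_simps)
  then have hT: "h * T = T * h" unfolding T_def by (rule commute_binomial_series[OF z(1)])
  have adjT: "adj T = T" by (simp add: T_def adj_binomial_series z)
  have "y * S = S * y" unfolding h S by (simp add: mult.assoc hT commute_left[OF hT])
  then have "(y + S) * (y - S) = 0" using SS y(2) by (simp add: algebra_simps)
  then have "(h * h + T * T) * (y - S) = 0" by (simp only: h S)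
  then have "y - S = 0"
    by (rule sum_squares_injective[OF h(1) adjT hT inv])
  then show ?thesis by (simp add: S_def)
qed

lemma positive_exp_half:
  fixes f :: "'a::cstar_algebra"
  assumes "adj f = f"
  shows "positive (exp ((1/2) *\<^sub>R f))"
  unfolding positive_def
proof (intro exI conjI)
  show "adj (exp ((1/4) *\<^sub>R f)) = exp ((1/4) *\<^sub>R f)" by (simp add: adj_exp adj_scaleR assms)
  show "exp ((1/2) *\<^sub>R f) = exp ((1/4) *\<^sub>R f) * exp ((1/4) *\<^sub>R f)"
    by (subst exp_add_commuting[symmetric]) (simp_all flip: scaleR_add_left)
qed

lemma exp_half_square: "exp ((1/2) *\<^sub>R f) * exp ((1/2) *\<^sub>R f) = exp (f::'a::{real_normed_algebra_1,banach})"
  by (subst exp_add_commuting[symmetric]) (simp_all flip: scaleR_add_left)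

text \<open>
  The exponential of a self-adjoint element is bounded below by a positive multiple of 1; scaled
  into the open unit ball around 1, it comes within reach of the binomial series. Both
  \<open>\<rho> - x\<close> and \<open>\<rho> + x\<close>, for \<open>x = 1 - s e\<^sup>f\<close> and \<open>\<rho> = 1 - \<delta>\<close>, are exhibited as squares.
\<close>

lemma norm_one_minus_scaled_exp_less_1:
  fixes f :: "'a::cstar_algebra"
  assumes f: "adj f = f"
  obtains s where "0 < s" "norm (1 - s *\<^sub>R exp f) < 1"
proof -
  define M where "M = norm (exp f) + norm (exp (- f)) + 1"
  have M: "norm (exp f) < M" "norm (exp (- f)) < M" "1 \<le> M" unfolding M_def
    by (simp_all add: add_pos_nonneg add_nonneg_pos)
  \<comment> \<open>With \<open>s\<close> below \<open>1 / norm (e\<^sup>f)\<close> and \<open>\<delta> / s\<close> below \<open>1 / norm (e\<^bsup>-f\<^esup>)\<close>, the elements \<open>z\<close> and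
    \<open>w\<close> below lie in the open unit ball, where the binomial square root exists.\<close>
  define s where "s = 1 / M"
  define \<delta> where "\<delta> = 1 / (2 * M\<^sup>2)"
  have M2: "1 \<le> M\<^sup>2" using M(3) by (simp add: one_le_power)
  have s: "0 < s" using M by (simp add: s_def)
  have "0 < 2 * M\<^sup>2" "1 < 2 * M\<^sup>2" using M2 by linarith+
  then have \<delta>: "0 < \<delta>" "\<delta> < 1" unfolding \<delta>_def by (simp_all only: divide_less_eq_1_pos zero_less_divide_1_iff)
  define b where "b = exp ((1/2) *\<^sub>R f)"
  have bb: "b * b = exp f" by (simp add: b_def exp_half_square)
  have E: "exp f * exp (- f) = 1" by (rule exp_minus_inverse)
  have b: "adj b = b" by (simp add: b_def adj_exp adj_scaleR f)
  define z where "z = - (\<delta> / s) *\<^sub>R exp (- f)"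
  define w where "w = - (s / (2 - \<delta>)) *\<^sub>R exp f"
  have z: "norm z < 1" 
  proof -
    have "norm z \<le> \<delta> / s * M" using M(2) s \<delta> by (simp add: z_def divide_right_mono)
    also have "\<dots> = 1 / 2" using M(3) by (simp add: s_def \<delta>_def power2_eq_square)
    finally show ?thesis by simp
  qed
  have w: "norm w < 1"
  proof -
    have "norm w = s / (2 - \<delta>) * norm (exp f)" using s \<delta> by (simp add: w_def)
    also have "\<dots> < s / (2 - \<delta>) * M" using M(1) s \<delta> by (intro mult_strict_left_mono) auto
    also have "\<dots> \<le> 1" using M(3) \<delta> by (simp add: s_def)
    finally show ?thesis .
  qed
  have zw: "adj z = z" "adj w = w" by (simp_all add: z_def w_def adj_scaleR adj_minus adj_exp f)
  \<comment> \<open>\<open>s e\<^sup>f - \<delta> = s e\<^sup>f (1 + z)\<close> and \<open>2 - \<delta> - s e\<^sup>f = (2 - \<delta>) (1 + w)\<close>.\<close>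
  define p where "p = sqrt s *\<^sub>R (b * binomial_series (1/2) z)"
  define q where "q = sqrt (2 - \<delta>) *\<^sub>R binomial_series (1/2) w"
  have com_b: "b * f = f * b" unfolding b_def by (rule commute_exp[symmetric]) simp
  have com_z: "c * binomial_series (1/2) z = binomial_series (1/2) z * c" if "c * f = f * c" for c
    using that by (intro commute_binomial_series[OF z]) (simp add: z_def commute_exp)
  have com_w: "c * binomial_series (1/2) w = binomial_series (1/2) w * c" if "c * f = f * c" for c
    using that by (intro commute_binomial_series[OF w]) (simp add: w_def commute_exp)
  define x where "x = 1 - s *\<^sub>R exp f"
  have com_x: "c * x = x * c" if "c * f = f * c" for c
    using that by (simp add: x_def algebra_simps commute_exp)
  have com_p: "c * p = p * c" if "c * f = f * c" for c
    using that com_z[OF that] commute_exp[of c "(1/2) *\<^sub>R f"]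
    by (simp add: p_def b_def mult.assoc commute_left[of c])
  have bz: "b * binomial_series (1/2) z = binomial_series (1/2) z * b" by (rule com_z[OF com_b])
  have "norm x \<le> 1 - \<delta>"
  proof (rule norm_le_of_squares[where p = p and q = q])
    show "adj x = x" by (simp add: x_def adj_diff adj_scaleR adj_exp f)
    show "adj p = p" using bz by (simp add: p_def adj_scaleR adj_mult b adj_binomial_series z zw)
    show "adj q = q" by (simp add: q_def adj_scaleR adj_binomial_series w zw)
    show "(1 - \<delta>) *\<^sub>R 1 - x = p * p"
    proof -
      have "p * p = s *\<^sub>R ((b * b) * (binomial_series (1/2) z * binomial_series (1/2) z))"
        using s by (simp add: p_def mult.assoc commute_left[OF bz])
      also have "binomial_series (1/2) z * binomial_series (1/2) z = 1 + z"
        using binomial_series_add[OF z, of "1/2" "1/2"] by (simp add: binomial_series_1)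
      also have "s *\<^sub>R (b * b * (1 + z)) = s *\<^sub>R exp f - \<delta> *\<^sub>R 1"
        using s E by (simp add: bb z_def algebra_simps)
      finally show ?thesis by (simp add: x_def algebra_simps)
    qed
    show "(1 - \<delta>) *\<^sub>R 1 + x = q * q"
    proof -
      have "q * q = (2 - \<delta>) *\<^sub>R (binomial_series (1/2) w * binomial_series (1/2) w)"
        using \<delta> by (simp add: q_def)
      also have "binomial_series (1/2) w * binomial_series (1/2) w = 1 + w"
        using binomial_series_add[OF w, of "1/2" "1/2"] by (simp add: binomial_series_1)
      also have "(2 - \<delta>) *\<^sub>R (1 + w) = (2 - \<delta>) *\<^sub>R 1 - s *\<^sub>R exp f"
        using \<delta> by (simp add: w_def scaleR_diff_right)
      finally show ?thesis by (simp add: x_def algebra_simps scaleR_2)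
    qed
    have fp: "f * p = p * f" by (rule com_p) simp
    have fq: "f * q = q * f" using com_w[of f] by (simp add: q_def)
    show "p * q = q * p" using com_w[OF fp[symmetric]] by (simp add: q_def)
    show "p * x = x * p" by (rule com_x[OF fp[symmetric]])
    show "q * x = x * q" by (rule com_x[OF fq[symmetric]])
  qed (use \<delta> in simp)
  then have "norm (1 - s *\<^sub>R exp f) < 1" using \<delta> by (simp add: x_def)
  with s show thesis by (rule that)
qed

lemma positive_scaleR: "0 \<le> r \<Longrightarrow> positive y \<Longrightarrow> positive (r *\<^sub>R (y::'a::cstar_algebra))"
proof -
  assume r: "0 \<le> r" and "positive y"
  then obtain h where h: "adj h = h" "y = h * h" by (auto simp: positive_def)
  then have "adj (sqrt r *\<^sub>R h) = sqrt r *\<^sub>R h" "r *\<^sub>R y = (sqrt r *\<^sub>R h) * (sqrt r *\<^sub>R h)"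
    using r by (simp_all add: adj_scaleR)
  then show ?thesis unfolding positive_def by blast
qed

text \<open>
  The definite description in \<^const>\<open>cstar_sqrt\<close> is meaningful here because every positive
  square root, rescaled, is the same binomial series.
\<close>

lemma cstar_sqrt_exp:
  fixes f :: "'a::cstar_algebra"
  assumes f: "adj f = f"
  shows "cstar_sqrt (exp f) = exp ((1/2) *\<^sub>R f)"
proof -
  obtain s where s: "0 < s" "norm (1 - s *\<^sub>R exp f) < 1"
    using norm_one_minus_scaled_exp_less_1[OF f] .
  define z where "z = s *\<^sub>R exp f - 1"
  have z: "norm z < 1" "adj z = z"
    using s by (simp_all add: z_def norm_minus_commute adj_diff adj_scaleR adj_exp f)
  have root: "sqrt s *\<^sub>R y = binomial_series (1/2) z" if "positive y" "y * y = exp f" for y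
    using s that by (intro positive_sqrt_eq_binomial_series z positive_scaleR) (auto simp: z_def)
  show ?thesis
    unfolding cstar_sqrt_def
  proof (rule the_equality)
    show "positive (exp ((1/2) *\<^sub>R f)) \<and> exp ((1/2) *\<^sub>R f) * exp ((1/2) *\<^sub>R f) = exp f"
      using positive_exp_half[OF f] exp_half_square by blast
    fix y assume "positive y \<and> y * y = exp f"
    then have "sqrt s *\<^sub>R y = sqrt s *\<^sub>R exp ((1/2) *\<^sub>R f)"
      using root[of y] root[OF positive_exp_half[OF f] exp_half_square] by simp
    with s(1) show "y = exp ((1/2) *\<^sub>R f)" by simp
  qed
qed

section \<open>Integer powers of unitaries\<close>

lemma unitary_adj: "unitary u \<Longrightarrow> unitary (adj u)"
  by (simp add: unitary_def adj_adj)

lemma unitary_mult: "unitary u \<Longrightarrow> unitary v \<Longrightarrow> unitary (u * v)"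
  unfolding unitary_def adj_mult by (metis mult.assoc mult_1_right)

lemma norm_unitary: "unitary u \<Longrightarrow> norm (u::'a::cstar_algebra) = 1"
  using cstar_identity[of u] norm_ge_zero[of u] by (auto simp: unitary_def power2_eq_1_iff)

lemma upow_0 [simp]: "upow u 0 = 1" and upow_1 [simp]: "upow u 1 = u"
  and upow_minus_1 [simp]: "upow u (- 1) = adj u"
  by (simp_all add: upow_def)

lemma upow_add_1: "unitary u \<Longrightarrow> upow u (k + 1) = upow u k * u"
proof (cases "k \<ge> 0")
  case True
  then show ?thesis by (simp add: upow_def nat_add_distrib power_commutes)
next
  case False
  assume u: "unitary u"
  define m where "m = nat (- (k + 1))"
  have "upow u k = adj u ^ m * adj u"
  proof -
    have "nat (- k) = Suc m" using False by (simp add: m_def)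
    then show ?thesis using False by (simp add: upow_def power_Suc2 del: power_Suc)
  qed
  moreover have "upow u (k + 1) = adj u ^ m"
    using False by (auto simp: upow_def m_def)
  ultimately show ?thesis using u by (simp add: unitary_def mult.assoc)
qed

lemma upow_diff_1: "unitary u \<Longrightarrow> upow u (k - 1) = upow u k * adj u"
  using upow_add_1[of u "k - 1"] by (simp add: mult.assoc unitary_def)

lemma upow_add: "unitary u \<Longrightarrow> upow u (j + k) = upow u j * upow u k"
proof (induction k rule: int_induct[where k = 0])
  case (step1 i)
  then show ?case
    using upow_add_1[of u "j + i"] upow_add_1[of u i] by (simp add: add.assoc mult.assoc)
next
  case (step2 i)
  then show ?case
    using upow_diff_1[of u "j + i"] upow_diff_1[of u i] by (simp add: add_diff_eq mult.assoc)
qed simp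

lemma unitary_upow: "unitary u \<Longrightarrow> unitary (upow u k)"
proof (induction k rule: int_induct[where k = 0])
  case base
  then show ?case by (simp add: unitary_def)
qed (simp_all add: upow_add_1 upow_diff_1 unitary_mult unitary_adj)

lemma unit_modulus_cnj: "cmod c = 1 \<Longrightarrow> cnj c * c = 1"
  by (metis complex_norm_square mult.commute of_real_1 one_power2)

lemma phase_commute_swap:
  fixes x y :: "'a::cstar_algebra"
  assumes "cmod c = 1" "x * y = c *\<^sub>C (y * x)"
  shows "y * x = cnj c *\<^sub>C (x * y)"
  using assms by (simp add: scaleC_scaleC unit_modulus_cnj scaleC_one)

text \<open>
  Moving \<open>y\<close> past one more factor \<open>x\<close> or \<open>x\<^sup>*\<close> contributes one more factor \<open>c\<close> or \<open>cnj c\<close>.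
\<close>

lemma phase_commute_upow:
  fixes x y :: "'a::cstar_algebra"
  assumes x: "unitary x" and c: "cmod c = 1" "x * y = c *\<^sub>C (y * x)"
  shows "\<exists>d. cmod d = 1 \<and> upow x k * y = d *\<^sub>C (y * upow x k)"
proof (induction k rule: int_induct[where k = 0])
  case base
  show ?case by (intro exI[of _ 1]) (simp add: scaleC_one)
next
  case (step1 i)
  then obtain d where d: "cmod d = 1" "upow x i * y = d *\<^sub>C (y * upow x i)" by blast
  have "upow x (i + 1) * y = upow x i * (x * y)" by (simp add: upow_add_1 x mult.assoc)
  also have "\<dots> = c *\<^sub>C ((upow x i * y) * x)" by (simp add: c(2) scaleC_mult_right mult.assoc)
  also have "\<dots> = (c * d) *\<^sub>C (y * upow x (i + 1))"
    by (simp add: d(2) scaleC_scaleC scaleC_mult_left upow_add_1 x mult.assoc)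
  finally show ?case using d c by (intro exI[of _ "c * d"]) (simp add: norm_mult)
next
  case (step2 i)
  then obtain d where d: "cmod d = 1" "upow x i * y = d *\<^sub>C (y * upow x i)" by blast
  have "adj x * y = adj x * (y * x) * adj x"
    using x by (simp add: unitary_def mult.assoc)
  also have "\<dots> = cnj c *\<^sub>C (adj x * (x * y) * adj x)"
    by (simp only: phase_commute_swap[OF c] scaleC_mult_left scaleC_mult_right)
  also have "adj x * (x * y) * adj x = y * adj x"
    using x by (simp add: unitary_def flip: mult.assoc)
  finally have xy: "adj x * y = cnj c *\<^sub>C (y * adj x)" .
  have "upow x (i - 1) * y = upow x i * (adj x * y)" by (simp add: upow_diff_1 x mult.assoc)
  also have "\<dots> = cnj c *\<^sub>C ((upow x i * y) * adj x)" by (simp add: xy scaleC_mult_right mult.assoc)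
  also have "\<dots> = (cnj c * d) *\<^sub>C (y * upow x (i - 1))"
    by (simp add: d(2) scaleC_scaleC scaleC_mult_left upow_diff_1 x mult.assoc)
  finally show ?case using d c by (intro exI[of _ "cnj c * d"]) (simp add: norm_mult)
qed

lemma phase_commute_upow_upow:
  fixes x y :: "'a::cstar_algebra"
  assumes "unitary x" "unitary y" "cmod c = 1" "x * y = c *\<^sub>C (y * x)"
  shows "\<exists>d. cmod d = 1 \<and> upow y l * upow x k = d *\<^sub>C (upow x k * upow y l)"
proof -
  obtain d where "cmod d = 1" "upow x k * y = d *\<^sub>C (y * upow x k)"
    using phase_commute_upow[OF assms(1,3,4)] by blast
  then have "cmod (cnj d) = 1" "y * upow x k = cnj d *\<^sub>C (upow x k * y)"
    by (simp, rule phase_commute_swap)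
  then show ?thesis by (rule phase_commute_upow[OF assms(2)])
qed

section \<open>The gauge action on the noncommutative torus\<close>

text \<open>
  The algebra itself as a competitor in its own universal property; the gauge action arises by
  sending the generators to rotated copies of themselves.
\<close>

definition full_cstar :: "'a::cstar_algebra cstar" where
  "full_cstar = \<lparr>carrier = UNIV, mult = (*), one = 1, zero = 0, add = (+), smult = (*\<^sub>C),
     star = adj, nrm = norm\<rparr>"

lemma full_cstar_simps [simp]:
  "carrier full_cstar = UNIV" "x \<otimes>\<^bsub>full_cstar\<^esub> y = x * y" "\<one>\<^bsub>full_cstar\<^esub> = 1"
  "\<zero>\<^bsub>full_cstar\<^esub> = 0" "x \<oplus>\<^bsub>full_cstar\<^esub> y = x + y" "c \<odot>\<^bsub>full_cstar\<^esub> x = c *\<^sub>C x"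
  "star full_cstar x = adj x" "nrm full_cstar x = norm x"
  by (simp_all add: full_cstar_def)

lemma cring_complex_ring: "cring complex_ring"
proof (rule cringI)
  show "abelian_group complex_ring"
    by (rule abelian_groupI) (auto simp: complex_ring_def intro: exI[of _ "- _"])
  show "comm_monoid complex_ring"
    by (rule comm_monoidI) (auto simp: complex_ring_def)
qed (auto simp: complex_ring_def algebra_simps)

lemma cstar_algebra_on_full_cstar: "cstar_algebra_on (full_cstar :: 'a::cstar_algebra cstar)"
proof -
  have abel: "abelian_group (full_cstar :: 'a cstar)"
    by (rule abelian_groupI) (auto simp: algebra_simps intro: exI[of _ "- _"])
  have ring: "ring (full_cstar :: 'a cstar)"
    by (rule ringI[OF abel]) (auto intro!: monoidI simp: algebra_simps)
  have module: "Module.module complex_ring (full_cstar :: 'a cstar)"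
    by (rule moduleI[OF cring_complex_ring abel])
       (auto simp: complex_ring_def scaleC_add_left scaleC_add_right scaleC_scaleC scaleC_one)
  have minus: "x \<ominus>\<^bsub>full_cstar\<^esub> y = x - (y::'a)" for x y
  proof -
    have "\<ominus>\<^bsub>full_cstar\<^esub> y = - y"
      by (rule abelian_group.minus_equality[OF abel]) auto
    then show ?thesis by (simp add: a_minus_def)
  qed
  have complete: "Metric_space.mcomplete (UNIV :: 'a set) dist"
    using mcomplete_iff_complete complete_UNIV by blast
  show ?thesis
    by (intro cstar_algebra_on.intro ring module cstar_algebra_on_axioms.intro)
       (auto simp: minus scaleC_mult_left scaleC_mult_right adj_adj adj_add adj_mult adj_scaleC
          norm_triangle_ineq norm_scaleC norm_mult_ineq cstar_identity complete
          simp flip: dist_norm)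
qed

locale nc_torus =
  fixes \<theta> :: real and U V :: "'a::cstar_algebra"
  assumes torus: "noncommutative_torus \<theta> U V"
begin

lemma unitary_U: "unitary U" and unitary_V: "unitary V"
  and UV: "U * V = exp (2 * of_real pi * \<i> * of_real \<theta>) *\<^sub>C (V * U)"
  using torus by (auto simp: noncommutative_torus_def)

lemma cmod_exp_\<theta>: "cmod (exp (2 * of_real pi * \<i> * of_real \<theta>)) = 1"
  by simp

text \<open>
  The unitaries \<open>U\<^sup>m V\<^sup>n\<close>, the common eigenvectors of the gauge action.
\<close>

definition W :: "int \<times> int \<Rightarrow> 'a" where
  "W p = upow U (fst p) * upow V (snd p)"

lemma unitary_W: "unitary (W p)"
  by (simp add: W_def unitary_mult unitary_upow unitary_U unitary_V)

lemma norm_W: "norm (W p) = 1"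
  by (rule norm_unitary[OF unitary_W])

lemma ex_phase: "\<exists>c. cmod c = 1 \<and> W p * W q = c *\<^sub>C W (p + q)"
proof -
  obtain d where d: "cmod d = 1"
      "upow V (snd p) * upow U (fst q) = d *\<^sub>C (upow U (fst q) * upow V (snd p))"
    using phase_commute_upow_upow[OF unitary_U unitary_V cmod_exp_\<theta> UV] by blast
  have "W p * W q = upow U (fst p) * (upow V (snd p) * upow U (fst q)) * upow V (snd q)"
    by (simp add: W_def mult.assoc)
  also have "\<dots> = d *\<^sub>C W (p + q)"
    by (simp add: d(2) W_def scaleC_mult_left scaleC_mult_right mult.assoc upow_add unitary_U unitary_V)
  finally show ?thesis using d(1) by blast
qed

text \<open>
  A power of \<open>e\<^bsup>2\<pi>\<i>\<theta>\<^esup>\<close>; modulus 1 is all that the estimates ask of it.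
\<close>

definition phase :: "int \<times> int \<Rightarrow> int \<times> int \<Rightarrow> complex" where
  "phase p q = (SOME c. cmod c = 1 \<and> W p * W q = c *\<^sub>C W (p + q))"

lemma cmod_phase: "cmod (phase p q) = 1" and W_mult: "W p * W q = phase p q *\<^sub>C W (p + q)"
  using someI_ex[OF ex_phase[of p q]] by (simp_all add: phase_def)

text \<open>
  The rotated generators satisfy the defining relations, so the universal property yields the
  homomorphism; contractivity makes it applicable termwise to Fourier series.
\<close>

lemma ex_gauge_hom:
  assumes "cmod z = 1" "cmod w = 1"
  obtains \<phi> :: "'a \<Rightarrow> 'a" where "bounded_linear \<phi>" "\<And>c x. \<phi> (c *\<^sub>C x) = c *\<^sub>C \<phi> x"
    "\<And>p. \<phi> (W p) = (z powi fst p * w powi snd p) *\<^sub>C W p"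
proof -
  have unitary: "unitary_on full_cstar (c *\<^sub>C u)" if "cmod c = 1" "unitary u" for c and u :: 'a
    using that unit_modulus_cnj[of c]
    by (simp add: unitary_on_def unitary_def adj_scaleC scaleC_mult_left scaleC_mult_right
        scaleC_scaleC scaleC_one mult.commute)
  have "(z *\<^sub>C U) * (w *\<^sub>C V) =
      exp (2 * of_real pi * \<i> * of_real \<theta>) *\<^sub>C ((w *\<^sub>C V) * (z *\<^sub>C U))"
    by (simp add: UV scaleC_mult_left scaleC_mult_right scaleC_scaleC mult_ac)
  then have "\<exists>!\<phi>. star_hom \<phi> full_cstar \<and> \<phi> U = z *\<^sub>C U \<and> \<phi> V = w *\<^sub>C V"
    using torus cstar_algebra_on_full_cstar unitary[OF assms(1) unitary_U] unitary[OF assms(2) unitary_V]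
    unfolding noncommutative_torus_def full_cstar_simps(2,6)[symmetric] by blast
  then obtain \<phi> where \<phi>: "star_hom \<phi> full_cstar" "\<phi> U = z *\<^sub>C U" "\<phi> V = w *\<^sub>C V" by blast
  then have hom: "\<phi> (x + y) = \<phi> x + \<phi> y" "\<phi> (x * y) = \<phi> x * \<phi> y" "\<phi> 1 = 1"
    "\<phi> (c *\<^sub>C x) = c *\<^sub>C \<phi> x" "\<phi> (adj x) = adj (\<phi> x)" for x y c
    by (simp_all add: star_hom_def)
  have "norm (\<phi> x) \<le> norm x" for x
    by (rule star_hom_contractive) (simp_all add: hom)
  then have bl: "bounded_linear \<phi>"
    by (intro bounded_linear_intro[where K = 1]) (simp_all add: hom flip: scaleC_of_real)
  have upow: "\<phi> (upow u k) = c powi k *\<^sub>C upow u k"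
    if u: "unitary u" and c: "cmod c = 1" and "\<phi> u = c *\<^sub>C u" for u c k
  proof (induction k rule: int_induct[where k = 0])
    case base
    show ?case by (simp add: hom scaleC_one)
  next
    case (step1 i)
    then show ?case using that
      by (auto simp: upow_add_1 hom scaleC_mult_left scaleC_mult_right scaleC_scaleC power_int_add_1 mult.commute)
  next
    case (step2 i)
    have "c \<noteq> 0" using c by auto
    have "cnj c = inverse c"
      using unit_modulus_cnj[OF c] by (intro inverse_unique[symmetric]) (simp add: mult.commute)
    then have "cnj c * c powi i = c powi (i - 1)"
      using \<open>c \<noteq> 0\<close> by (simp add: power_int_diff divide_inverse)
    with step2 that show ?case
      by (simp add: upow_diff_1 hom scaleC_mult_left scaleC_mult_right scaleC_scaleC adj_scaleC)
  qed
  have "\<phi> (W p) = (z powi fst p * w powi snd p) *\<^sub>C W p" for p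
    using upow[OF unitary_U assms(1) \<phi>(2)] upow[OF unitary_V assms(2) \<phi>(3)]
    by (simp add: W_def hom scaleC_mult_left scaleC_mult_right scaleC_scaleC mult.commute)
  with bl hom(4) show thesis by (rule that)
qed

end

section \<open>Rapidly decreasing families\<close>

text \<open>
  The factor of the decay condition. It is submultiplicative, which makes weighted summability
  stable under convolution.
\<close>

definition weight :: "int \<times> int \<Rightarrow> real" where
  "weight p = 1 + \<bar>real_of_int (fst p)\<bar> + \<bar>real_of_int (snd p)\<bar>"

lemma weight_ge_1: "1 \<le> weight p"
  by (simp add: weight_def)

lemma weight_add_le: "weight (p + q) \<le> weight p * weight q"
proof -
  have "weight (p + q) \<le> 1 + (\<bar>real_of_int (fst p)\<bar> + \<bar>real_of_int (snd p)\<bar>)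
      + (\<bar>real_of_int (fst q)\<bar> + \<bar>real_of_int (snd q)\<bar>)"
    by (simp add: weight_def)
  also have "\<dots> \<le> weight p * weight q"
    by (simp add: weight_def algebra_simps)
  finally show ?thesis .
qed

lemma summable_on_inverse_square_int:
  "(\<lambda>m::int. 1 / (1 + \<bar>real_of_int m\<bar>)\<^sup>2) summable_on UNIV"
proof -
  have "summable (\<lambda>n. 1 / real (Suc n) ^ 2)"
    using inverse_power_summable[of 2, where 'a = real]
    by (subst summable_Suc_iff) (simp add: inverse_eq_divide)
  then have nat: "(\<lambda>n::nat. 1 / (1 + \<bar>real n\<bar>)\<^sup>2) summable_on UNIV"
    by (subst summable_on_UNIV_nonneg_real_iff) (auto simp: add.commute)
  have "(\<lambda>m::int. 1 / (1 + \<bar>real_of_int m\<bar>)\<^sup>2) summable_on range int"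
       "(\<lambda>m::int. 1 / (1 + \<bar>real_of_int m\<bar>)\<^sup>2) summable_on range (\<lambda>n. - int n)"
    using nat by (subst summable_on_reindex; simp add: inj_on_def o_def)+
  then have "(\<lambda>m::int. 1 / (1 + \<bar>real_of_int m\<bar>)\<^sup>2) summable_on (range int \<union> range (\<lambda>n. - int n))"
    by (rule summable_on_union)
  also have "range int \<union> range (\<lambda>n. - int n) = UNIV"
  proof -
    have "m \<in> range int \<union> range (\<lambda>n. - int n)" for m
      by (cases m rule: int_cases2) auto
    then show ?thesis by blast
  qed
  finally show ?thesis .
qed

lemma summable_on_product_real:
  fixes A :: "'b \<Rightarrow> real" and B :: "'c \<Rightarrow> real"
  assumes A: "A summable_on UNIV" "\<And>p. 0 \<le> A p" and B: "B summable_on UNIV" "\<And>q. 0 \<le> B q"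
  shows "(\<lambda>(p, q). A p * B q) summable_on UNIV"
proof -
  have "(\<lambda>(p, q). A p * B q) summable_on (Sigma UNIV (\<lambda>_. UNIV))"
  proof (rule summable_on_SigmaI)
    show "((\<lambda>q. case (p, q) of (p, q) \<Rightarrow> A p * B q) has_sum (A p * infsum B UNIV)) UNIV" for p
      using B(1) by (auto intro: has_sum_cmult_right)
    show "(\<lambda>p. A p * infsum B UNIV) summable_on UNIV"
      using A(1) by (rule summable_on_cmult_left)
  qed (use A B in auto)
  then show ?thesis by simp
qed

text \<open>
  Four additional powers of the weight dominate \<open>(1 + |m|)\<^sup>2 (1 + |n|)\<^sup>2\<close>, whose inverse is summable
  over the lattice.
\<close>

lemma rapidly_decreasing_iff_summable:
  "rapidly_decreasing a \<longleftrightarrow> (\<forall>k. (\<lambda>p. weight p ^ k * cmod (a p)) summable_on UNIV)"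
proof
  assume a: "rapidly_decreasing a"
  show "\<forall>k. (\<lambda>p. weight p ^ k * cmod (a p)) summable_on UNIV"
  proof
    fix k
    obtain C where "\<forall>m n. (1 + \<bar>real_of_int m\<bar> + \<bar>real_of_int n\<bar>) ^ (k + 4) * cmod (a (m, n)) \<le> C"
      using a unfolding rapidly_decreasing_def by blast
    then have C: "weight p ^ (k + 4) * cmod (a p) \<le> C" for p
      by (cases p) (simp add: weight_def)
    have "(\<lambda>(m, n). 1 / (1 + \<bar>real_of_int m\<bar>)\<^sup>2 * (1 / (1 + \<bar>real_of_int n\<bar>)\<^sup>2)) summable_on UNIV"
      by (intro summable_on_product_real summable_on_inverse_square_int) auto
    then have "(\<lambda>p. C * (case p of (m, n) \<Rightarrow> 1 / (1 + \<bar>real_of_int m\<bar>)\<^sup>2 * (1 / (1 + \<bar>real_of_int n\<bar>)\<^sup>2))) summable_on UNIV"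
      by (rule summable_on_cmult_right)
    then show "(\<lambda>p. weight p ^ k * cmod (a p)) summable_on UNIV"
    proof (rule summable_on_comparison_test)
      fix p :: "int \<times> int"
      obtain m n where p: "p = (m, n)" by fastforce
      define x where "x = 1 + \<bar>real_of_int m\<bar>"
      define y where "y = 1 + \<bar>real_of_int n\<bar>"
      have xy: "1 \<le> x" "1 \<le> y" "x \<le> weight p" "y \<le> weight p"
        by (auto simp: x_def y_def p weight_def)
      have "x * x * (y * y) \<le> weight p * weight p * (weight p * weight p)"
        using xy by (intro mult_mono) auto
      then have "weight p ^ k * cmod (a p) * (x\<^sup>2 * y\<^sup>2) \<le> weight p ^ k * cmod (a p) * weight p ^ 4"
        using weight_ge_1[of p]
        by (intro mult_left_mono) (auto simp: power2_eq_square power4_eq_xxxx mult.assoc)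
      also have "\<dots> \<le> C" using C[of p] by (simp add: power_add mult_ac)
      finally have "weight p ^ k * cmod (a p) * (x\<^sup>2 * y\<^sup>2) \<le> C" .
      then have "weight p ^ k * cmod (a p) \<le> C / (x\<^sup>2 * y\<^sup>2)"
        using xy by (simp add: pos_le_divide_eq)
      then show "weight p ^ k * cmod (a p) \<le> C * (case p of (m, n) \<Rightarrow> 1 / (1 + \<bar>real_of_int m\<bar>)\<^sup>2 * (1 / (1 + \<bar>real_of_int n\<bar>)\<^sup>2))"
        by (simp add: p x_def y_def)
    qed (use weight_ge_1 order_trans[OF zero_le_one] in \<open>auto intro!: mult_nonneg_nonneg zero_le_power\<close>)
  qed
next
  assume sum: "\<forall>k. (\<lambda>p. weight p ^ k * cmod (a p)) summable_on UNIV"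
  have nonneg: "0 \<le> weight p ^ k * cmod (a p)" for p k
    using weight_ge_1[of p] by simp
  have bound: "weight p ^ k * cmod (a p) \<le> (\<Sum>\<^sub>\<infinity>p. weight p ^ k * cmod (a p))" for p k
    using finite_sum_le_infsum[OF sum[rule_format], of "{p}" k] nonneg by simp
  show "rapidly_decreasing a"
    unfolding rapidly_decreasing_def
  proof (intro allI exI)
    fix k m n
    show "(1 + \<bar>real_of_int m\<bar> + \<bar>real_of_int n\<bar>) ^ k * cmod (a (m, n)) \<le> (\<Sum>\<^sub>\<infinity>p. weight p ^ k * cmod (a p))"
      using bound[of "(m, n)" k] by (simp add: weight_def)
  qed
qed

lemma rapidly_decreasing_abs_summable:
  "rapidly_decreasing a \<Longrightarrow> (\<lambda>p. cmod (a p)) summable_on UNIV"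
  using rapidly_decreasing_iff_summable[of a] by (auto dest: spec[of _ 0])

lemma rapidly_decreasing_dominated:
  assumes "rapidly_decreasing a" "\<And>p. cmod (b p) \<le> weight p ^ l * cmod (a p)"
  shows "rapidly_decreasing b"
  unfolding rapidly_decreasing_iff_summable
proof
  fix k
  have "(\<lambda>p. weight p ^ (k + l) * cmod (a p)) summable_on UNIV"
    using assms(1) rapidly_decreasing_iff_summable by blast
  then show "(\<lambda>p. weight p ^ k * cmod (b p)) summable_on UNIV"
  proof (rule summable_on_comparison_test)
    fix p
    have "0 \<le> weight p ^ k" using weight_ge_1[of p] by simp
    then show "0 \<le> weight p ^ k * cmod (b p)" by simp
    show "weight p ^ k * cmod (b p) \<le> weight p ^ (k + l) * cmod (a p)"
      using mult_left_mono[OF assms(2) \<open>0 \<le> weight p ^ k\<close>] by (simp add: power_add mult.assoc)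
  qed
qed

lemma rapidly_decreasing_add:
  assumes "rapidly_decreasing a" "rapidly_decreasing b"
  shows "rapidly_decreasing (\<lambda>p. a p + b p)"
  unfolding rapidly_decreasing_iff_summable
proof
  fix k
  have "(\<lambda>p. weight p ^ k * cmod (a p) + weight p ^ k * cmod (b p)) summable_on UNIV"
    using assms unfolding rapidly_decreasing_iff_summable by (intro summable_on_add) auto
  then show "(\<lambda>p. weight p ^ k * cmod (a p + b p)) summable_on UNIV"
  proof (rule summable_on_comparison_test)
    fix p
    have "0 \<le> weight p ^ k" using weight_ge_1[of p] by simp
    then show "0 \<le> weight p ^ k * cmod (a p + b p)" 
      and "weight p ^ k * cmod (a p + b p) \<le> weight p ^ k * cmod (a p) + weight p ^ k * cmod (b p)"
      using mult_left_mono[OF norm_triangle_ineq[of "a p" "b p"]] by (auto simp: distrib_left)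
  qed
qed

section \<open>Uniqueness of Fourier coefficients\<close>

lemma sum_root_unity_powi:
  fixes N :: nat and k :: int
  assumes k: "\<bar>k\<bar> < int N" "k \<noteq> 0"
  shows "(\<Sum>j<N. cis (2 * pi * real j / real N) powi k) = 0"
proof -
  have N: "0 < N" using k by auto
  define q where "q = cis (2 * pi * real_of_int k / real N)"
  have "q \<noteq> 1"
  proof
    assume "q = 1"
    then obtain n :: int where "2 * pi * real_of_int k / real N = of_int n * (2 * pi)"
      unfolding q_def cis_eq_1_iff by blast
    then have "2 * pi * real_of_int k = of_int n * (2 * pi) * real N"
      using N by (simp add: divide_eq_eq)
    then have "real_of_int k = real_of_int (n * int N)" by simp
    then have "k = n * int N" by (simp only: of_int_eq_iff)
    then have "int N dvd k" by simp
    then have "int N \<le> \<bar>k\<bar>" using dvd_imp_le_int[OF k(2)] by fastforce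
    then show False using k by simp
  qed
  have "cis (2 * pi * real j / real N) powi k = q ^ j" for j
    by (simp add: q_def cis_power_int Complex.DeMoivre mult_ac)
  then have "(\<Sum>j<N. cis (2 * pi * real j / real N) powi k) = (\<Sum>j<N. q ^ j)" by simp
  also have "\<dots> = (q ^ N - 1) / (q - 1)" by (rule geometric_sum[OF \<open>q \<noteq> 1\<close>])
  also have "q ^ N = cis (2 * pi * real_of_int k)"
    using N by (simp add: q_def Complex.DeMoivre)
  also have "\<dots> = 1" by (rule cis_multiple_2pi) simp
  finally show ?thesis by simp
qed

lemma has_sum_finite_sum:
  fixes f :: "'i \<Rightarrow> 'b \<Rightarrow> 'c::topological_comm_monoid_add"
  assumes "finite I" "\<And>i. i \<in> I \<Longrightarrow> (f i has_sum s i) A"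
  shows "((\<lambda>x. \<Sum>i\<in>I. f i x) has_sum (\<Sum>i\<in>I. s i)) A"
  using assms by (induction I rule: finite_induct) (auto intro: has_sum_add)

context nc_torus begin

lemma fourier_expansion_iff:
  "fourier_expansion U V a x \<longleftrightarrow> rapidly_decreasing a \<and> ((\<lambda>p. a p *\<^sub>C W p) has_sum x) UNIV"
  by (simp add: fourier_expansion_def W_def case_prod_beta')

text \<open>
  The sums \<open>S\<close> over the \<open>N\<close>-th roots of unity come from averaging the gauge-rotated series. They
  vanish at the nonzero frequencies below \<open>N\<close>, so the average isolates the coefficient at \<open>(m, n)\<close> up
  to far away frequencies. A finite average replaces the integral over the torus.
\<close>

lemma has_sum_gauge_average:
  fixes N :: nat
  assumes sum: "((\<lambda>p. a p *\<^sub>C W p) has_sum 0) UNIV"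
  defines "S \<equiv> \<lambda>k. (\<Sum>j<N. cis (2 * pi * real j / real N) powi k)"
  shows "((\<lambda>p. (S (fst p - m) * S (snd p - n) * a p) *\<^sub>C W p) has_sum 0) UNIV"
proof -
  have rotated: "((\<lambda>p. (z powi (fst p - m) * w powi (snd p - n) * a p) *\<^sub>C W p) has_sum 0) UNIV"
    if zw: "cmod z = 1" "cmod w = 1" for z w
  proof -
    obtain \<phi> where \<phi>: "bounded_linear \<phi>" "\<And>c x. \<phi> (c *\<^sub>C x) = c *\<^sub>C \<phi> x"
      "\<And>p. \<phi> (W p) = (z powi fst p * w powi snd p) *\<^sub>C W p"
      using ex_gauge_hom[OF zw] by blast
    have nz: "z \<noteq> 0" "w \<noteq> 0" using zw by auto
    have "((\<lambda>p. \<phi> (a p *\<^sub>C W p)) has_sum \<phi> 0) UNIV"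
      by (rule has_sum_bounded_linear[OF \<phi>(1) sum])
    then have "((\<lambda>p. (z powi (- m) * w powi (- n)) *\<^sub>C \<phi> (a p *\<^sub>C W p)) has_sum
        (z powi (- m) * w powi (- n)) *\<^sub>C \<phi> 0) UNIV"
      by (rule has_sum_bounded_linear[OF bounded_linear_scaleC_right])
    also have "\<phi> 0 = 0" using \<phi>(2)[of 0 0] by simp
    finally show ?thesis
      using nz by (simp add: \<phi> scaleC_scaleC power_int_diff power_int_minus divide_inverse mult_ac)
  qed
  have "((\<lambda>p. \<Sum>(j, l)\<in>{..<N} \<times> {..<N}. (cis (2 * pi * real j / real N) powi (fst p - m) *
      cis (2 * pi * real l / real N) powi (snd p - n) * a p) *\<^sub>C W p) has_sum
      (\<Sum>(j, l)\<in>{..<N} \<times> {..<N}. 0)) UNIV"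
    unfolding case_prod_beta' by (intro has_sum_finite_sum rotated) auto
  moreover have "(\<Sum>(j, l)\<in>{..<N} \<times> {..<N}. (cis (2 * pi * real j / real N) powi (fst p - m) *
      cis (2 * pi * real l / real N) powi (snd p - n) * a p) *\<^sub>C W p)
      = (S (fst p - m) * S (snd p - n) * a p) *\<^sub>C W p" for p
  proof -
    have "(\<Sum>i\<in>I. f i *\<^sub>C x) = (\<Sum>i\<in>I. f i) *\<^sub>C x" for I and f :: "nat \<times> nat \<Rightarrow> complex" and x :: 'a
      by (induction I rule: infinite_finite_induct) (auto simp: scaleC_add_left)
    then show ?thesis
      by (simp add: S_def sum_product sum.cartesian_product case_prod_beta' flip: sum_distrib_right)
  qed
  ultimately show ?thesis by (simp add: case_prod_beta')
qed

text \<open>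
  Outside a large finite set \<open>F\<close> the coefficients have total mass at most \<open>\<epsilon>\<close>. Averaging over roots of
  unity of an order exceeding all distances from \<open>(m, n)\<close> to \<open>F\<close> kills the rest of \<open>F\<close>, so the
  coefficient at \<open>(m, n)\<close> equals a sum over far frequencies and is at most \<open>\<epsilon>\<close>.
\<close>

lemma zero_sum_imp_zero_coeff:
  assumes abs: "(\<lambda>p. cmod (a p)) summable_on UNIV"
    and sum: "((\<lambda>p. a p *\<^sub>C W p) has_sum 0) UNIV"
  shows "a p = 0"
proof -
  obtain m n where p: "p = (m, n)" by fastforce
  have "cmod (a p) \<le> \<epsilon>" if "0 < \<epsilon>" for \<epsilon>
  proof -
    obtain F where F: "finite F" "dist (\<Sum>p\<in>F. cmod (a p)) (\<Sum>\<^sub>\<infinity>p. cmod (a p)) \<le> \<epsilon>"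
      using infsum_finite_approximation[OF abs \<open>0 < \<epsilon>\<close>] by blast
    define N where "N = Suc (nat (\<Sum>q\<in>F. \<bar>fst q - m\<bar> + \<bar>snd q - n\<bar>))"
    have N: "\<bar>fst q - m\<bar> < int N" "\<bar>snd q - n\<bar> < int N" if "q \<in> F" for q
    proof -
      have "\<bar>fst q - m\<bar> + \<bar>snd q - n\<bar> \<le> (\<Sum>q\<in>F. \<bar>fst q - m\<bar> + \<bar>snd q - n\<bar>)"
        by (rule member_le_sum[OF that _ F(1)]) auto
      moreover have "0 \<le> (\<Sum>q\<in>F. \<bar>fst q - m\<bar> + \<bar>snd q - n\<bar>)"
        by (rule sum_nonneg) simp
      ultimately show "\<bar>fst q - m\<bar> < int N" "\<bar>snd q - n\<bar> < int N"
        unfolding N_def by linarith+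
    qed
    define S where "S = (\<lambda>k. \<Sum>j<N. cis (2 * pi * real j / real N) powi k)"
    have S0: "S 0 = of_nat N" by (simp add: S_def)
    have Sz: "S k = 0" if "\<bar>k\<bar> < int N" "k \<noteq> 0" for k
      unfolding S_def by (rule sum_root_unity_powi[OF that])
    have Sb: "cmod (S k) \<le> real N" for k
    proof -
      have "cmod (S k) \<le> (\<Sum>j<N. cmod (cis (2 * pi * real j / real N) powi k))"
        unfolding S_def by (rule norm_sum)
      then show ?thesis by (simp add: norm_power_int)
    qed
    define g where "g = (\<lambda>q. (S (fst q - m) * S (snd q - n) * a q) *\<^sub>C W q)"
    have "(g has_sum 0) UNIV"
      unfolding g_def S_def by (rule has_sum_gauge_average[OF sum])
    then have "(g has_sum (0 - g p)) (UNIV - {p})"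
      by (rule has_sum_Diff) (auto simp: has_sum_finiteI)
    then have "(g has_sum (- g p)) (- F - {p})"
    proof -
      assume "(g has_sum (0 - g p)) (UNIV - {p})"
      then have "(g has_sum (- g p)) (UNIV - {p})" by simp
      also have "?this \<longleftrightarrow> ?thesis"
      proof (rule has_sum_cong_neutral)
        fix q assume "q \<in> (UNIV - {p}) - (- F - {p})"
        then have q: "q \<in> F" "q \<noteq> (m, n)" by (auto simp: p)
        then have "fst q - m \<noteq> 0 \<or> snd q - n \<noteq> 0" by (auto simp: prod_eq_iff)
        then show "g q = 0" using Sz N[OF q(1)] by (auto simp: g_def)
      qed auto
      finally show ?thesis .
    qed
    moreover have tail: "(\<lambda>q. (real N)\<^sup>2 * cmod (a q)) summable_on (- F - {p})"
      by (intro summable_on_cmult_right summable_on_subset_banach[OF abs]) auto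
    have gb: "norm (g q) \<le> (real N)\<^sup>2 * cmod (a q)" for q
      using mult_mono[OF Sb[of "fst q - m"] Sb[of "snd q - n"]]
      by (simp add: g_def norm_scaleC norm_W norm_mult power2_eq_square mult_right_mono)
    have gabs: "(\<lambda>q. norm (g q)) summable_on (- F - {p})"
      by (rule Infinite_Sum.abs_summable_on_comparison_test'[OF tail gb])
    ultimately have "norm (- g p) \<le> (\<Sum>\<^sub>\<infinity>q\<in>- F - {p}. norm (g q))"
      by (intro norm_has_sum_bound[OF has_sum_infsum])
    also have "\<dots> \<le> (\<Sum>\<^sub>\<infinity>q\<in>- F - {p}. (real N)\<^sup>2 * cmod (a q))"
      by (rule infsum_mono[OF gabs tail gb])
    also have "\<dots> = (real N)\<^sup>2 * (\<Sum>\<^sub>\<infinity>q\<in>- F - {p}. cmod (a q))"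
      by (rule infsum_cmult_right') 
    also have "\<dots> \<le> (real N)\<^sup>2 * \<epsilon>"
    proof (rule mult_left_mono)
      have "(\<Sum>\<^sub>\<infinity>q\<in>- F - {p}. cmod (a q)) \<le> (\<Sum>\<^sub>\<infinity>q\<in>UNIV - F. cmod (a q))"
        by (intro infsum_mono_neutral summable_on_subset_banach[OF abs]) auto
      also have "\<dots> = (\<Sum>\<^sub>\<infinity>q. cmod (a q)) - (\<Sum>q\<in>F. cmod (a q))"
        using infsum_Diff[of "\<lambda>q. cmod (a q)" UNIV F] abs F(1) by simp
      also have "\<dots> \<le> \<epsilon>" using F(2) by (simp add: dist_real_def)
      finally show "(\<Sum>\<^sub>\<infinity>q\<in>- F - {p}. cmod (a q)) \<le> \<epsilon>" .
    qed simp
    finally have "(real N)\<^sup>2 * cmod (a p) \<le> (real N)\<^sup>2 * \<epsilon>"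
      by (simp add: g_def p S0 norm_scaleC norm_W norm_mult power2_eq_square)
    then show ?thesis by (simp add: N_def)
  qed
  then have "cmod (a p) \<le> 0" by (rule field_le_epsilon[of _ 0, simplified])
  then show ?thesis by simp
qed

lemma fourier_expansion_unique:
  assumes a: "fourier_expansion U V a x" and b: "fourier_expansion U V b x"
  shows "a = b"
proof
  fix p
  have "((\<lambda>p. a p *\<^sub>C W p + (-1) *\<^sub>C (b p *\<^sub>C W p)) has_sum (x + (-1) *\<^sub>C x)) UNIV"
    using a b by (intro has_sum_add has_sum_bounded_linear[OF bounded_linear_scaleC_right])
      (auto simp: fourier_expansion_iff)
  then have sum: "((\<lambda>p. (a p - b p) *\<^sub>C W p) has_sum 0) UNIV"
    by (simp add: scaleC_minus_left scaleC_diff_left scaleC_one)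
  have "(\<lambda>p. cmod (a p) + cmod (b p)) summable_on UNIV"
    using a b by (intro summable_on_add rapidly_decreasing_abs_summable) (auto simp: fourier_expansion_iff)
  then have "(\<lambda>p. cmod (a p - b p)) summable_on UNIV"
    by (rule Infinite_Sum.abs_summable_on_comparison_test') (rule norm_triangle_ineq4)
  then have "a p - b p = 0" using sum by (rule zero_sum_imp_zero_coeff)
  then show "a p = b p" by simp
qed

lemma fourier_coeff_eq: "fourier_expansion U V a x \<Longrightarrow> fourier_coeff U V x = a"
  unfolding fourier_coeff_def by (rule the_equality) (auto intro: fourier_expansion_unique)


section \<open>The smooth subalgebra and its derivations\<close>

definition twisted_conv :: "(int \<times> int \<Rightarrow> complex) \<Rightarrow> (int \<times> int \<Rightarrow> complex) \<Rightarrow> int \<times> int \<Rightarrow> complex" where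
  "twisted_conv a b s = (\<Sum>\<^sub>\<infinity>p. phase p (s - p) * a p * b (s - p))"

lemma summable_on_convolution:
  fixes A B :: "int \<times> int \<Rightarrow> real"
  assumes "A summable_on UNIV" "\<And>p. 0 \<le> A p" "B summable_on UNIV" "\<And>q. 0 \<le> B q"
  shows "(\<lambda>(s, p). A p * B (s - p)) summable_on UNIV"
proof -
  have bij: "bij_betw (\<lambda>(s, p). (p, s - p)) UNIV (UNIV :: ((int \<times> int) \<times> (int \<times> int)) set)"
    by (rule bij_betwI[where g = "\<lambda>(p, q). (p + q, p)"]) auto
  have "(\<lambda>x. case (case x of (s, p) \<Rightarrow> (p, s - p)) of (p, q) \<Rightarrow> A p * B q) summable_on UNIV"
    using summable_on_product_real[OF assms] by (subst summable_on_reindex_bij_betw[OF bij])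
  then show ?thesis by (simp add: case_prod_beta')
qed

lemma summable_weighted_conv_terms:
  assumes "rapidly_decreasing a" "rapidly_decreasing b"
  shows "(\<lambda>(s, p). weight s ^ k * cmod (phase p (s - p) * a p * b (s - p))) summable_on UNIV"
proof -
  have nonneg: "0 \<le> weight p ^ k * cmod z" for p z
    using weight_ge_1[of p] by simp
  have "(\<lambda>(s, p). (weight p ^ k * cmod (a p)) * (weight (s - p) ^ k * cmod (b (s - p)))) summable_on UNIV"
    using assms by (intro summable_on_convolution nonneg) (auto simp: rapidly_decreasing_iff_summable)
  then show ?thesis
  proof (rule summable_on_comparison_test)
    fix x :: "(int \<times> int) \<times> (int \<times> int)"
    obtain s p where x: "x = (s, p)" by (rule prod.exhaust)
    have "weight s ^ k \<le> (weight p * weight (s - p)) ^ k"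
      using weight_add_le[of p "s - p"] weight_ge_1[of s] by (intro power_mono) auto
    then have "weight s ^ k * (cmod (a p) * cmod (b (s - p)))
        \<le> (weight p ^ k * weight (s - p) ^ k) * (cmod (a p) * cmod (b (s - p)))"
      by (intro mult_right_mono) (auto simp: power_mult_distrib)
    then show "(case x of (s, p) \<Rightarrow> weight s ^ k * cmod (phase p (s - p) * a p * b (s - p)))
        \<le> (case x of (s, p) \<Rightarrow> (weight p ^ k * cmod (a p)) * (weight (s - p) ^ k * cmod (b (s - p))))"
      by (simp add: x norm_mult cmod_phase mult_ac)
  qed (auto intro: nonneg)
qed

lemma has_sum_conv:
  assumes "rapidly_decreasing a" "rapidly_decreasing b"
  shows "((\<lambda>p. phase p (s - p) * a p * b (s - p)) has_sum twisted_conv a b s) UNIV"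
proof -
  have "(\<lambda>(s, p). cmod (phase p (s - p) * a p * b (s - p))) summable_on Sigma UNIV (\<lambda>_. UNIV)"
    using summable_weighted_conv_terms[OF assms, of 0] by simp
  then have "(\<lambda>p. cmod (phase p (s - p) * a p * b (s - p))) summable_on UNIV"
    by (rule summable_on_SigmaD1[of "\<lambda>s p. cmod (phase p (s - p) * a p * b (s - p))"]) auto
  then have "(\<lambda>p. phase p (s - p) * a p * b (s - p)) summable_on UNIV"
    by (rule abs_summable_summable)
  then show ?thesis unfolding twisted_conv_def by (rule has_sum_infsum)
qed

lemma rapidly_decreasing_conv:
  assumes "rapidly_decreasing a" "rapidly_decreasing b"
  shows "rapidly_decreasing (twisted_conv a b)"
  unfolding rapidly_decreasing_iff_summable
proof
  fix k
  have nonneg: "0 \<le> weight s ^ k" for s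
    using weight_ge_1[of s] by simp
  have sum: "(\<lambda>(s, p). weight s ^ k * cmod (phase p (s - p) * a p * b (s - p))) summable_on Sigma UNIV (\<lambda>_. UNIV)"
    using summable_weighted_conv_terms[OF assms] by simp
  have inner: "(\<lambda>p. weight s ^ k * cmod (phase p (s - p) * a p * b (s - p))) summable_on UNIV" for s
    using summable_on_SigmaD1[OF sum, of s] nonneg[of s] by simp
  have "(\<lambda>s. \<Sum>\<^sub>\<infinity>p. weight s ^ k * cmod (phase p (s - p) * a p * b (s - p))) summable_on UNIV"
    by (rule summable_on_Sigma_banach[OF sum])
  then show "(\<lambda>s. weight s ^ k * cmod (twisted_conv a b s)) summable_on UNIV"
  proof (rule summable_on_comparison_test)
    fix s
    show "0 \<le> weight s ^ k * cmod (twisted_conv a b s)" using nonneg[of s] by simp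
    have "weight s ^ k * cmod (twisted_conv a b s) = norm (of_real (weight s ^ k) * twisted_conv a b s)"
      by (simp only: norm_mult[of "of_real _"] norm_of_real abs_of_nonneg[OF nonneg])
    also have "\<dots> \<le> (\<Sum>\<^sub>\<infinity>p. weight s ^ k * cmod (phase p (s - p) * a p * b (s - p)))"
    proof (rule norm_has_sum_bound)
      show "((\<lambda>p. of_real (weight s ^ k) * (phase p (s - p) * a p * b (s - p))) has_sum
          of_real (weight s ^ k) * twisted_conv a b s) UNIV"
        by (rule has_sum_cmult_right[OF has_sum_conv[OF assms]])
      have "norm (of_real (weight s ^ k) * (phase p (s - p) * a p * b (s - p)))
          = weight s ^ k * cmod (phase p (s - p) * a p * b (s - p))" for p
        by (simp only: norm_mult[of "of_real _"] norm_of_real abs_of_nonneg[OF nonneg])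
      then show "((\<lambda>p. norm (of_real (weight s ^ k) * (phase p (s - p) * a p * b (s - p)))) has_sum
          (\<Sum>\<^sub>\<infinity>p. weight s ^ k * cmod (phase p (s - p) * a p * b (s - p)))) UNIV"
        using inner[of s] by simp
    qed
    finally show "weight s ^ k * cmod (twisted_conv a b s)
        \<le> (\<Sum>\<^sub>\<infinity>p. weight s ^ k * cmod (phase p (s - p) * a p * b (s - p)))" .
  qed
qed

text \<open>
  The absolutely convergent double series of the product is summed in two ways: along rows it gives
  \<open>x y\<close>, along the fibres of \<open>(p, q) \<mapsto> p + q\<close> it gives the series of the twisted convolution.
\<close>

lemma fourier_expansion_mult:
  assumes "fourier_expansion U V a x" "fourier_expansion U V b y"
  shows "fourier_expansion U V (twisted_conv a b) (x * y)"
proof -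
  have a: "rapidly_decreasing a" "((\<lambda>p. a p *\<^sub>C W p) has_sum x) UNIV"
    and b: "rapidly_decreasing b" "((\<lambda>p. b p *\<^sub>C W p) has_sum y) UNIV"
    using assms by (auto simp: fourier_expansion_iff)
  have product: "(a p *\<^sub>C W p) * (b (s - p) *\<^sub>C W (s - p)) = (phase p (s - p) * a p * b (s - p)) *\<^sub>C W s" for p s
    by (simp add: scaleC_mult_left scaleC_mult_right scaleC_scaleC W_mult mult_ac)
  have "(\<lambda>(p, q). cmod (a p) * cmod (b q)) summable_on UNIV"
    by (intro summable_on_product_real rapidly_decreasing_abs_summable a b) auto
  then have "(\<lambda>z. norm (case z of (p, q) \<Rightarrow> (a p *\<^sub>C W p) * (b q *\<^sub>C W q))) summable_on UNIV"
    by (rule Infinite_Sum.abs_summable_on_comparison_test')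
       (auto simp: norm_scaleC norm_W intro!: order_trans[OF norm_mult_ineq])
  then have "(\<lambda>(p, q). (a p *\<^sub>C W p) * (b q *\<^sub>C W q)) summable_on UNIV"
    by (rule abs_summable_summable)
  then obtain S where S: "((\<lambda>(p, q). (a p *\<^sub>C W p) * (b q *\<^sub>C W q)) has_sum S) UNIV"
    by (auto simp: summable_on_def)
  have "((\<lambda>p. (a p *\<^sub>C W p) * y) has_sum S) UNIV"
  proof (rule has_sum_SigmaD)
    show "((\<lambda>(p, q). (a p *\<^sub>C W p) * (b q *\<^sub>C W q)) has_sum S) (Sigma UNIV (\<lambda>_. UNIV))"
      using S by simp
    show "((\<lambda>q. case (p, q) of (p, q) \<Rightarrow> (a p *\<^sub>C W p) * (b q *\<^sub>C W q)) has_sum (a p *\<^sub>C W p) * y) UNIV" for p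
      using has_sum_cmult_right[OF b(2)] by simp
  qed
  then have "S = x * y"
    using has_sum_cmult_left[OF a(2), of y] by (rule has_sum_unique)
  have bij: "bij_betw (\<lambda>(s, p). (p, s - p)) UNIV (UNIV :: ((int \<times> int) \<times> (int \<times> int)) set)"
    by (rule bij_betwI[where g = "\<lambda>(p, q). (p + q, p)"]) auto
  have "((\<lambda>z. (\<lambda>(p, q). (a p *\<^sub>C W p) * (b q *\<^sub>C W q)) ((\<lambda>(s, p). (p, s - p)) z)) has_sum S) UNIV"
    using S by (subst has_sum_reindex_bij_betw[OF bij])
  then have "((\<lambda>(s, p). (phase p (s - p) * a p * b (s - p)) *\<^sub>C W s) has_sum S) (Sigma UNIV (\<lambda>_. UNIV))"
    by (simp add: case_prod_beta' product)
  then have "((\<lambda>s. twisted_conv a b s *\<^sub>C W s) has_sum S) UNIV"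
  proof (rule has_sum_SigmaD)
    have bl: "bounded_linear (\<lambda>c. c *\<^sub>C W s)" for s
      by (rule bounded_linear_intro[where K = 1])
         (auto simp: scaleC_add_left scaleR_scaleC scaleR_conv_of_real[where 'a = complex] norm_scaleC norm_W)
    show "((\<lambda>p. case (s, p) of (s, p) \<Rightarrow> (phase p (s - p) * a p * b (s - p)) *\<^sub>C W s) has_sum twisted_conv a b s *\<^sub>C W s) UNIV" for s
      using has_sum_bounded_linear[OF bl has_sum_conv[OF a(1) b(1), of s]] by simp
  qed
  then show ?thesis
    using rapidly_decreasing_conv[OF a(1) b(1)] by (simp add: fourier_expansion_iff \<open>S = x * y\<close>)
qed

lemma fourier_expansion_add:
  assumes "fourier_expansion U V a x" "fourier_expansion U V b y"
  shows "fourier_expansion U V (\<lambda>p. a p + b p) (x + y)"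
  using assms by (auto simp: fourier_expansion_iff rapidly_decreasing_add scaleC_add_left intro: has_sum_add)

lemma fourier_expansion_scaleC:
  assumes "fourier_expansion U V a x"
  shows "fourier_expansion U V (\<lambda>p. c * a p) (c *\<^sub>C x)"
proof -
  have a: "rapidly_decreasing a" "((\<lambda>p. a p *\<^sub>C W p) has_sum x) UNIV"
    using assms by (auto simp: fourier_expansion_iff)
  have "rapidly_decreasing (\<lambda>p. c * a p)"
    unfolding rapidly_decreasing_iff_summable
  proof
    fix k
    have "(\<lambda>p. cmod c * (weight p ^ k * cmod (a p))) summable_on UNIV"
      using a(1) by (intro summable_on_cmult_right) (simp add: rapidly_decreasing_iff_summable)
    then show "(\<lambda>p. weight p ^ k * cmod (c * a p)) summable_on UNIV"
      by (simp add: norm_mult mult_ac)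
  qed
  then show ?thesis
    using has_sum_bounded_linear[OF bounded_linear_scaleC_right a(2), of c]
    by (simp add: fourier_expansion_iff scaleC_scaleC)
qed

lemma fourier_expansion_W: "fourier_expansion U V (\<lambda>q. if q = p then 1 else 0) (W p)"
proof -
  have "(\<lambda>q. weight q ^ k * cmod (if q = p then 1 else 0)) summable_on UNIV" for k
    by (rule finite_nonzero_values_imp_summable_on) (auto intro: finite_subset[of _ "{p}"])
  moreover have "((\<lambda>q. (if q = p then 1 else 0) *\<^sub>C W q) has_sum W p) UNIV"
    by (rule has_sum_finite_neutralI[of "{p}"]) (auto simp: scaleC_one)
  ultimately show ?thesis by (simp add: fourier_expansion_iff rapidly_decreasing_iff_summable)
qed

definition frequency :: "2 \<Rightarrow> int \<times> int \<Rightarrow> int" where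
  "frequency i p = (if i = 1 then fst p else snd p)"

lemma frequency_add: "frequency i (p + q) = frequency i p + frequency i q" and abs_frequency_le: "\<bar>real_of_int (frequency i p)\<bar> \<le> weight p"
  by (auto simp: frequency_def weight_def)

lemma deriv_nc_eq: "fourier_expansion U V a x \<Longrightarrow>
    deriv_nc U V i x = (\<Sum>\<^sub>\<infinity>p. (of_int (frequency i p) * a p) *\<^sub>C W p)"
  by (simp add: deriv_nc_def fourier_coeff_eq frequency_def W_def case_prod_beta')

lemma fourier_expansion_deriv:
  assumes "fourier_expansion U V a x"
  shows "fourier_expansion U V (\<lambda>p. of_int (frequency i p) * a p) (deriv_nc U V i x)"
proof -
  have "rapidly_decreasing a" using assms by (simp add: fourier_expansion_iff)
  then have rapid: "rapidly_decreasing (\<lambda>p. of_int (frequency i p) * a p)"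
    by (rule rapidly_decreasing_dominated[where l = 1])
       (auto simp: norm_mult intro!: mult_right_mono abs_frequency_le)
  have "(\<lambda>p. norm ((of_int (frequency i p) * a p) *\<^sub>C W p)) summable_on UNIV"
    using rapidly_decreasing_abs_summable[OF rapid] by (simp add: norm_scaleC norm_W)
  then have "(\<lambda>p. (of_int (frequency i p) * a p) *\<^sub>C W p) summable_on UNIV"
    by (rule abs_summable_summable)
  then have "((\<lambda>p. (of_int (frequency i p) * a p) *\<^sub>C W p) has_sum deriv_nc U V i x) UNIV"
    unfolding deriv_nc_eq[OF assms] by (rule has_sum_infsum)
  with rapid show ?thesis by (simp add: fourier_expansion_iff)
qed

lemma fourier_expansion_eqI:
  "fourier_expansion U V a x \<Longrightarrow> fourier_expansion U V a y \<Longrightarrow> x = y"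
  using has_sum_unique by (auto simp: fourier_expansion_iff)

lemma smoothE: "x \<in> smooth U V \<Longrightarrow> (\<And>a. fourier_expansion U V a x \<Longrightarrow> thesis) \<Longrightarrow> thesis"
  by (auto simp: smooth_def)

lemma smoothI: "fourier_expansion U V a x \<Longrightarrow> x \<in> smooth U V"
  by (auto simp: smooth_def)

lemma smooth_add: "x \<in> smooth U V \<Longrightarrow> y \<in> smooth U V \<Longrightarrow> x + y \<in> smooth U V"
  by (meson smoothE smoothI fourier_expansion_add)

lemma smooth_mult: "x \<in> smooth U V \<Longrightarrow> y \<in> smooth U V \<Longrightarrow> x * y \<in> smooth U V"
  by (meson smoothE smoothI fourier_expansion_mult)

lemma smooth_scaleC: "x \<in> smooth U V \<Longrightarrow> c *\<^sub>C x \<in> smooth U V"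
  by (meson smoothE smoothI fourier_expansion_scaleC)

lemma smooth_deriv: "x \<in> smooth U V \<Longrightarrow> deriv_nc U V i x \<in> smooth U V"
  by (meson smoothE smoothI fourier_expansion_deriv)

lemma smooth_W: "W p \<in> smooth U V"
  by (rule smoothI[OF fourier_expansion_W])

lemma W_0: "W 0 = 1"
  by (simp add: W_def)

lemma smooth_one: "1 \<in> smooth U V"
  using smooth_W[of 0] by (simp add: W_0)

lemma smooth_zero: "0 \<in> smooth U V"
  using smooth_scaleC[OF smooth_one, of 0] by simp

lemma smooth_scaleR: "x \<in> smooth U V \<Longrightarrow> r *\<^sub>R x \<in> smooth U V"
  using smooth_scaleC[of x "of_real r"] by (simp add: scaleC_of_real)

lemma smooth_minus: "x \<in> smooth U V \<Longrightarrow> - x \<in> smooth U V"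
  using smooth_scaleR[of x "-1"] by simp

lemma smooth_diff: "x \<in> smooth U V \<Longrightarrow> y \<in> smooth U V \<Longrightarrow> x - y \<in> smooth U V"
  using smooth_add[of x "- y"] by (simp add: smooth_minus)

lemma deriv_add:
  assumes "x \<in> smooth U V" "y \<in> smooth U V"
  shows "deriv_nc U V i (x + y) = deriv_nc U V i x + deriv_nc U V i y"
proof -
  obtain a b where ab: "fourier_expansion U V a x" "fourier_expansion U V b y"
    using assms by (auto elim!: smoothE)
  show ?thesis
    using fourier_expansion_deriv[OF fourier_expansion_add[OF ab], of i]
      fourier_expansion_add[OF ab[THEN fourier_expansion_deriv, of i]]
    by (intro fourier_expansion_eqI) (auto simp: distrib_left)
qed

lemma deriv_scaleC:
  assumes "x \<in> smooth U V"
  shows "deriv_nc U V i (c *\<^sub>C x) = c *\<^sub>C deriv_nc U V i x"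
proof -
  obtain a where a: "fourier_expansion U V a x" using assms by (auto elim!: smoothE)
  show ?thesis
    using fourier_expansion_deriv[OF fourier_expansion_scaleC[OF a], of i c]
      fourier_expansion_scaleC[OF fourier_expansion_deriv[OF a], of c i]
    by (intro fourier_expansion_eqI) (auto simp: mult_ac)
qed

lemma deriv_scaleR: "x \<in> smooth U V \<Longrightarrow> deriv_nc U V i (r *\<^sub>R x) = r *\<^sub>R deriv_nc U V i x"
  using deriv_scaleC[of x i "of_real r"] by (simp add: scaleC_of_real)

lemma deriv_minus: "x \<in> smooth U V \<Longrightarrow> deriv_nc U V i (- x) = - deriv_nc U V i x"
  using deriv_scaleR[of x i "-1"] by simp

lemma deriv_diff: "x \<in> smooth U V \<Longrightarrow> y \<in> smooth U V \<Longrightarrow>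
    deriv_nc U V i (x - y) = deriv_nc U V i x - deriv_nc U V i y"
  using deriv_add[of x "- y"] by (simp add: smooth_minus deriv_minus)

lemma deriv_zero: "deriv_nc U V i 0 = 0"
  using deriv_scaleR[OF smooth_zero, of i 0] by simp

lemma deriv_W: "deriv_nc U V i (W p) = of_int (frequency i p) *\<^sub>C W p"
  using fourier_expansion_deriv[OF fourier_expansion_W, of i p]
    fourier_expansion_scaleC[OF fourier_expansion_W, of "of_int (frequency i p)" p]
  by (intro fourier_expansion_eqI) (auto simp: if_distrib cong: if_cong)

lemma deriv_one: "deriv_nc U V i 1 = 0"
  using deriv_W[of i 0] by (simp add: W_0 frequency_def)

text \<open>
  The frequency of \<open>W p * W q\<close> is the sum of the frequencies of the factors, so the Leibniz rule
  already holds for every term of the twisted convolution.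
\<close>

lemma deriv_mult:
  assumes "x \<in> smooth U V" "y \<in> smooth U V"
  shows "deriv_nc U V i (x * y) = deriv_nc U V i x * y + x * deriv_nc U V i y"
proof -
  obtain a b where ab: "fourier_expansion U V a x" "fourier_expansion U V b y"
    using assms by (auto elim!: smoothE)
  define a' where "a' = (\<lambda>p. of_int (frequency i p) * a p)"
  define b' where "b' = (\<lambda>p. of_int (frequency i p) * b p)"
  have ab': "fourier_expansion U V a' (deriv_nc U V i x)" "fourier_expansion U V b' (deriv_nc U V i y)"
    unfolding a'_def b'_def by (intro fourier_expansion_deriv ab)+
  have rapid: "rapidly_decreasing a" "rapidly_decreasing b" "rapidly_decreasing a'" "rapidly_decreasing b'"
    using ab ab' by (auto simp: fourier_expansion_iff)
  have "twisted_conv a' b s + twisted_conv a b' s = of_int (frequency i s) * twisted_conv a b s" for s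
  proof (rule has_sum_unique)
    show "((\<lambda>p. phase p (s - p) * a' p * b (s - p) + phase p (s - p) * a p * b' (s - p)) has_sum
        (twisted_conv a' b s + twisted_conv a b' s)) UNIV"
      by (intro has_sum_add has_sum_conv rapid)
    have "phase p (s - p) * a' p * b (s - p) + phase p (s - p) * a p * b' (s - p)
        = of_int (frequency i s) * (phase p (s - p) * a p * b (s - p))" for p
      using frequency_add[of i p "s - p"] by (simp add: a'_def b'_def algebra_simps)
    then show "((\<lambda>p. phase p (s - p) * a' p * b (s - p) + phase p (s - p) * a p * b' (s - p)) has_sum
        of_int (frequency i s) * twisted_conv a b s) UNIV"
      using has_sum_cmult_right[OF has_sum_conv[OF rapid(1,2), of s], of "of_int (frequency i s)"] by simp
  qed
  then have "fourier_expansion U V (\<lambda>s. of_int (frequency i s) * twisted_conv a b s) (deriv_nc U V i x * y + x * deriv_nc U V i y)"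
    using fourier_expansion_add[OF fourier_expansion_mult[OF ab'(1) ab(2)] fourier_expansion_mult[OF ab(1) ab'(2)]]
    by simp
  then show ?thesis
    by (rule fourier_expansion_eqI[OF fourier_expansion_deriv[OF fourier_expansion_mult[OF ab]]])
qed

text \<open>
  The derivation multiplies the coefficient at the origin by the frequency 0.
\<close>

lemma trace_deriv: "x \<in> smooth U V \<Longrightarrow> nc_trace U V (deriv_nc U V i x) = 0"
  by (erule smoothE) (simp add: nc_trace_def fourier_coeff_eq[OF fourier_expansion_deriv] frequency_def)

end

section \<open>The potential and its exponentials\<close>

lemma power_div_fact_le_exp: "0 \<le> (x::real) \<Longrightarrow> x ^ n / fact n \<le> exp x"
proof -
  assume x: "0 \<le> x"
  have "(\<Sum>k\<in>{n}. x ^ k /\<^sub>R fact k) \<le> (\<Sum>k. x ^ k /\<^sub>R fact k)"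
    by (rule sum_le_suminf[OF summable_exp_generic]) (use x in auto)
  then show ?thesis by (simp add: exp_def divide_inverse mult.commute)
qed

context nc_torus begin

text \<open>
  For \<open>e \<noteq> 0\<close>, the Fourier coefficients of the exponential of \<open>t V\<^sup>e\<close>: \<open>t\<^sup>n / n!\<close> at \<open>(0, e n)\<close>.
\<close>

definition exp_coeff :: "int \<Rightarrow> real \<Rightarrow> int \<times> int \<Rightarrow> complex" where
  "exp_coeff e t p = (if p \<in> range (\<lambda>n. (0, e * int n))
     then of_real (t ^ nat (snd p div e) / fact (nat (snd p div e))) else 0)"

lemma exp_coeff_range: "e \<noteq> 0 \<Longrightarrow> exp_coeff e t (0, e * int n) = of_real (t ^ n / fact n)"
  by (auto simp: exp_coeff_def)

lemma exp_coeff_off_range: "p \<notin> range (\<lambda>n. (0, e * int n)) \<Longrightarrow> exp_coeff e t p = 0"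
  by (auto simp: exp_coeff_def)

lemma rapidly_decreasing_exp_coeff:
  assumes e: "e \<noteq> 0"
  shows "rapidly_decreasing (exp_coeff e t)"
  unfolding rapidly_decreasing_def
proof
  fix k
  define A where "A = exp \<bar>real_of_int e\<bar> * \<bar>t\<bar>"
  define C where "C = fact k * exp 1 * exp A"
  have bound: "weight p ^ k * cmod (exp_coeff e t p) \<le> C" for p
  proof (cases "p \<in> range (\<lambda>n. (0, e * int n))")
    case True
    then obtain n where p: "p = (0, e * int n)" by blast
    have weight: "weight p = 1 + \<bar>real_of_int e\<bar> * real n" by (simp add: weight_def p abs_mult)
    have "weight p ^ k / fact k \<le> exp (weight p)"
      using weight_ge_1[of p] by (intro power_div_fact_le_exp) auto
    then have "weight p ^ k \<le> fact k * (exp 1 * exp \<bar>real_of_int e\<bar> ^ n)"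
      by (simp add: weight exp_add field_simps flip: exp_of_nat_mult)
    then have "weight p ^ k * (\<bar>t\<bar> ^ n / fact n) \<le> fact k * (exp 1 * exp \<bar>real_of_int e\<bar> ^ n) * (\<bar>t\<bar> ^ n / fact n)"
      by (rule mult_right_mono) simp
    also have "\<dots> = fact k * exp 1 * (A ^ n / fact n)"
      by (simp add: A_def power_mult_distrib)
    also have "\<dots> \<le> C"
      unfolding C_def by (intro mult_left_mono power_div_fact_le_exp) (auto simp: A_def)
    finally show ?thesis
      by (simp add: p exp_coeff_range[OF e] norm_divide norm_power)
  next
    case False
    then show ?thesis by (simp add: exp_coeff_off_range C_def A_def)
  qed
  show "\<exists>C. \<forall>m n. (1 + \<bar>real_of_int m\<bar> + \<bar>real_of_int n\<bar>) ^ k * cmod (exp_coeff e t (m, n)) \<le> C"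
    using bound[of "(_, _)"] by (auto simp: weight_def)
qed

lemma W_power: "W (0, e) ^ n = W (0, e * int n)"
proof (induction n)
  case 0
  show ?case by (simp add: W_def)
next
  case (Suc n)
  then show ?case
    by (simp add: W_def upow_add unitary_V distrib_left)
qed

lemma has_sum_V_axis_iff:
  fixes f :: "int \<times> int \<Rightarrow> 'a"
  assumes "e \<noteq> 0" "\<And>p. p \<notin> range (\<lambda>n. (0, e * int n)) \<Longrightarrow> f p = 0"
  shows "((\<lambda>n. f (0, e * int n)) has_sum S) UNIV \<longleftrightarrow> (f has_sum S) UNIV"
proof -
  have "inj (\<lambda>n. (0::int, e * int n))" using assms(1) by (auto simp: inj_def)
  then have "((\<lambda>n. f (0, e * int n)) has_sum S) UNIV \<longleftrightarrow> (f has_sum S) (range (\<lambda>n. (0, e * int n)))"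
    by (subst has_sum_reindex) (auto simp: o_def)
  also have "\<dots> \<longleftrightarrow> (f has_sum S) UNIV"
    by (rule has_sum_cong_neutral) (use assms(2) in auto)
  finally show ?thesis .
qed

lemma exp_term: "(t *\<^sub>R W (0, e)) ^ n /\<^sub>R fact n = complex_of_real (t ^ n / fact n) *\<^sub>C W (0, e * int n)"
  by (simp add: W_power scaleC_of_real divide_inverse mult.commute power_mult_distrib scaleR_power 
      del: of_real_divide of_real_mult of_real_power)

lemma fourier_expansion_exp:
  assumes e: "e \<noteq> 0"
  shows "fourier_expansion U V (exp_coeff e t) (exp (t *\<^sub>R W (0, e)))"
proof -
  have "((\<lambda>n. (t *\<^sub>R W (0, e)) ^ n /\<^sub>R fact n) has_sum exp (t *\<^sub>R W (0, e))) UNIV"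
    by (intro norm_summable_imp_has_sum summable_norm_exp exp_converges)
  then have "((\<lambda>n. exp_coeff e t (0, e * int n) *\<^sub>C W (0, e * int n)) has_sum exp (t *\<^sub>R W (0, e))) UNIV"
    by (simp only: exp_term exp_coeff_range[OF e])
  then have "((\<lambda>p. exp_coeff e t p *\<^sub>C W p) has_sum exp (t *\<^sub>R W (0, e))) UNIV"
    by (subst (asm) has_sum_V_axis_iff[OF e]) (simp_all add: exp_coeff_off_range)
  then show ?thesis by (simp add: fourier_expansion_iff rapidly_decreasing_exp_coeff e)
qed

lemma deriv_1_exp: "e \<noteq> 0 \<Longrightarrow> deriv_nc U V 1 (exp (t *\<^sub>R W (0, e))) = 0"
  unfolding deriv_nc_eq[OF fourier_expansion_exp]
  by (rule infsum_0) (auto simp: frequency_def exp_coeff_def)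

text \<open>
  Termwise differentiation turns the exponential series into its own shift.
\<close>

lemma deriv_2_exp:
  assumes e: "e \<noteq> 0"
  shows "deriv_nc U V 2 (exp (t *\<^sub>R W (0, e))) = (of_int e * t) *\<^sub>R (W (0, e) * exp (t *\<^sub>R W (0, e)))"
proof -
  let ?X = "t *\<^sub>R W (0, e)"
  let ?h = "\<lambda>n. (of_int e * real n) *\<^sub>R (?X ^ n /\<^sub>R fact n)"
  have "((\<lambda>p. (of_int (frequency 2 p) * exp_coeff e t p) *\<^sub>C W p) has_sum deriv_nc U V 2 (exp ?X)) UNIV"
    using fourier_expansion_deriv[OF fourier_expansion_exp[OF e]] by (simp add: fourier_expansion_iff)
  then have "((\<lambda>n. (of_int (frequency 2 (0, e * int n)) * exp_coeff e t (0, e * int n)) *\<^sub>C W (0, e * int n))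
      has_sum deriv_nc U V 2 (exp ?X)) UNIV"
    by (subst has_sum_V_axis_iff[OF e]) (simp_all add: exp_coeff_off_range)
  moreover have "(of_int (frequency 2 (0, e * int n)) * exp_coeff e t (0, e * int n)) *\<^sub>C W (0, e * int n) = ?h n" for n
    by (simp only: exp_term scaleR_scaleC exp_coeff_range[OF e]) (simp add: frequency_def)
  ultimately have "(?h has_sum deriv_nc U V 2 (exp ?X)) UNIV" by simp
  then have lhs: "?h sums deriv_nc U V 2 (exp ?X)" by (rule has_sum_imp_sums)
  have step: "?h (Suc n) = of_int e *\<^sub>R (?X * (?X ^ n /\<^sub>R fact n))" for n
  proof -
    have "real (Suc n) * inverse (fact (Suc n)) = inverse (fact n)"
      unfolding fact_Suc of_nat_mult by (simp del: of_nat_Suc)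
    then have "of_int e * real (Suc n) * inverse (fact (Suc n)) = real_of_int e * inverse (fact n)"
      by (simp only: mult.assoc)
    then show ?thesis by (simp only: scaleR_scaleR mult_scaleR_right power_Suc)
  qed
  have "(\<lambda>n. ?h (Suc n)) sums (of_int e *\<^sub>R (?X * exp ?X))"
    unfolding step by (intro sums_scaleR_right sums_mult exp_converges)
  then have "?h sums (of_int e *\<^sub>R (?X * exp ?X))"
    by (subst (asm) sums_Suc_iff) simp
  with lhs have "deriv_nc U V 2 (exp ?X) = of_int e *\<^sub>R (?X * exp ?X)" by (rule sums_unique2)
  then show ?thesis by simp
qed

text \<open>
  The function \<open>f\<close> of the metric and its derivative in the second direction.
\<close>

definition potential :: 'a where "potential = 2 *\<^sub>R (V + adj V)"
definition potential' :: 'a where "potential' = 2 *\<^sub>R (V - adj V)"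

lemma V_W: "V = W (0, 1)" "adj V = W (0, -1)"
  by (simp_all add: W_def)

lemma V_adj_V: "V * adj V = 1" "adj V * V = 1"
  using unitary_V by (auto simp: unitary_def)

lemma potential_commute: "potential' * potential = potential * potential'"
  by (simp add: potential_def potential'_def algebra_simps V_adj_V)

lemma adj_potential: "adj potential = potential"
  by (simp add: potential_def adj_scaleR adj_add adj_adj add.commute)

lemma exp_potential: "exp (t *\<^sub>R potential) = exp ((2 * t) *\<^sub>R V) * exp ((2 * t) *\<^sub>R adj V)"
  by (subst exp_add_commuting[symmetric])
     (simp_all add: V_adj_V potential_def mult.commute scaleR_add_right)

lemma smooth_V: "V \<in> smooth U V" and smooth_adj_V: "adj V \<in> smooth U V"
  using smooth_W[of "(0, 1)"] smooth_W[of "(0, -1)"] by (simp_all add: V_W[symmetric])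

lemma smooth_potential: "potential \<in> smooth U V" "potential' \<in> smooth U V"
  by (simp_all add: potential_def potential'_def smooth_scaleR smooth_add smooth_diff smooth_V smooth_adj_V)

lemma deriv_V: "deriv_nc U V 1 V = 0" "deriv_nc U V 1 (adj V) = 0"
    "deriv_nc U V 2 V = V" "deriv_nc U V 2 (adj V) = - adj V"
  using deriv_W[of 1 "(0, 1)"] deriv_W[of 1 "(0, -1)"] deriv_W[of 2 "(0, 1)"] deriv_W[of 2 "(0, -1)"]
  by (simp_all add: V_W[symmetric] frequency_def scaleC_one scaleC_minus_left)

lemma deriv_potential:
  "deriv_nc U V 1 potential = 0" "deriv_nc U V 1 potential' = 0"
  "deriv_nc U V 2 potential = potential'" "deriv_nc U V 2 potential' = potential"
  by (simp_all add: potential_def potential'_def deriv_scaleR deriv_add deriv_diff smooth_add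
      smooth_diff smooth_V smooth_adj_V deriv_V)

lemma smooth_exp_V: "exp (t *\<^sub>R V) \<in> smooth U V" "exp (t *\<^sub>R adj V) \<in> smooth U V"
  using smoothI[OF fourier_expansion_exp[of 1 t]] smoothI[OF fourier_expansion_exp[of "-1" t]]
  by (simp_all add: V_W[symmetric])

lemma smooth_exp_potential: "exp (t *\<^sub>R potential) \<in> smooth U V"
  by (simp add: exp_potential smooth_mult smooth_exp_V)

lemma deriv_exp_V:
  "deriv_nc U V 1 (exp (t *\<^sub>R V)) = 0" "deriv_nc U V 1 (exp (t *\<^sub>R adj V)) = 0"
  "deriv_nc U V 2 (exp (t *\<^sub>R V)) = t *\<^sub>R (V * exp (t *\<^sub>R V))"
  "deriv_nc U V 2 (exp (t *\<^sub>R adj V)) = - (t *\<^sub>R (adj V * exp (t *\<^sub>R adj V)))"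
  using deriv_1_exp[of 1 t] deriv_1_exp[of "-1" t] deriv_2_exp[of 1 t] deriv_2_exp[of "-1" t]
  by (simp_all add: V_W[symmetric])

text \<open>
  Since \<open>V\<close> and \<open>V\<^sup>*\<close> commute, \<open>e\<^bsup>tf\<^esup>\<close> splits into two exponentials of monomials, and the Leibniz rule
  reassembles their derivatives.
\<close>

lemma deriv_exp_potential:
  "deriv_nc U V 1 (exp (t *\<^sub>R potential)) = 0"
  "deriv_nc U V 2 (exp (t *\<^sub>R potential)) = t *\<^sub>R (potential' * exp (t *\<^sub>R potential))"
proof -
  show "deriv_nc U V 1 (exp (t *\<^sub>R potential)) = 0"
    by (simp add: exp_potential deriv_mult smooth_exp_V deriv_exp_V)
  have swap: "exp (s *\<^sub>R V) * (adj V * exp (s *\<^sub>R adj V)) = adj V * (exp (s *\<^sub>R V) * exp (s *\<^sub>R adj V))" for s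
    by (rule commute_left[symmetric], rule commute_exp) (simp add: V_adj_V)
  show "deriv_nc U V 2 (exp (t *\<^sub>R potential)) = t *\<^sub>R (potential' * exp (t *\<^sub>R potential))"
    by (simp add: exp_potential deriv_mult smooth_exp_V deriv_exp_V potential'_def swap
        algebra_simps)
qed

end

section \<open>Levi-Civita connection and curvature\<close>

lemma inner_nc_diag_metric_basis:
  "inner_nc (diag_metric f) X (basis_field k) = X $ k * (if k = 1 then exp f else 1)"
proof -
  have "(2::2) \<noteq> 1" by simp
  with exhaust_2[of k] show ?thesis
    by (auto simp: inner_nc_def sum_2 diag_metric_def basis_field_def axis_def)
qed

context nc_torus begin

definition christoffel :: "2 \<Rightarrow> 2 \<Rightarrow> 2 \<Rightarrow> 'a" where
  "christoffel i j k = (1/2) *\<^sub>R (deriv_nc U V i (diag_metric potential $ j $ k)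
     + deriv_nc U V j (diag_metric potential $ i $ k) - deriv_nc U V k (diag_metric potential $ i $ j))"

lemma exp_potential_inverse:
  "exp potential * exp (- potential) = 1" "exp (- potential) * exp potential = 1"
  using exp_minus_inverse[of potential] exp_minus_inverse[of "- potential"] by simp_all

lemma smooth_exp_potential_1: "exp potential \<in> smooth U V" "exp (- potential) \<in> smooth U V"
  using smooth_exp_potential[of 1] smooth_exp_potential[of "-1"] by simp_all

lemma deriv_exp_potential_1:
  "deriv_nc U V 1 (exp potential) = 0" "deriv_nc U V 2 (exp potential) = potential' * exp potential"
  using deriv_exp_potential[of 1] by simp_all

lemma christoffel_simps:
  "christoffel 1 1 1 = 0" "christoffel 1 1 2 = - (1/2) *\<^sub>R (potential' * exp potential)"
  "christoffel 1 2 1 = (1/2) *\<^sub>R (potential' * exp potential)" "christoffel 1 2 2 = 0"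
  "christoffel 2 1 1 = (1/2) *\<^sub>R (potential' * exp potential)" "christoffel 2 1 2 = 0"
  "christoffel 2 2 1 = 0" "christoffel 2 2 2 = 0"
  by (simp_all add: christoffel_def diag_metric_def deriv_exp_potential_1 deriv_zero deriv_one)

lemma smooth_christoffel: "christoffel i j k \<in> smooth U V"
  using smooth_exp_potential_1 smooth_one smooth_zero
  by (auto simp: christoffel_def diag_metric_def intro!: smooth_scaleR smooth_diff smooth_add smooth_deriv)

lemma smooth_sum: "(\<And>j. j \<in> I \<Longrightarrow> f j \<in> smooth U V) \<Longrightarrow> (\<Sum>j\<in>I. f j) \<in> smooth U V"
  by (induction I rule: infinite_finite_induct) (auto simp: smooth_zero smooth_add)

lemma basis_in_vector_fields: "basis_field i \<in> vector_fields U V"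
  by (simp add: vector_fields_def basis_field_def axis_def smooth_zero smooth_one)

text \<open>
  The components are forced on the basis fields by the Christoffel symbols, where the invertible
  entry \<open>e\<^sup>f\<close> is divided out on the right; the Leibniz rule then determines the connection.
\<close>

lemma ex_levi_civita: "\<exists>D. levi_civita U V (diag_metric potential) D"
proof
  define C where "C i j k = christoffel i j k * (if k = 1 then exp (- potential) else 1)" for i j k
  define D :: "2 \<Rightarrow> 'a ^ 2 \<Rightarrow> 'a ^ 2" where
    "D i X = (\<chi> k. deriv_nc U V i (X $ k) + (\<Sum>j\<in>UNIV. X $ j * C i j k))" for i X
  have C: "C i j k \<in> smooth U V" for i j k
    by (simp add: C_def smooth_mult smooth_christoffel smooth_exp_potential_1 smooth_one)
  have "D i X \<in> vector_fields U V" if "X \<in> vector_fields U V" for i X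
    using that by (auto simp: vector_fields_def D_def intro!: smooth_add smooth_deriv smooth_sum smooth_mult C)
  moreover have "D i (X + Y) = D i X + D i Y"
    if "X \<in> vector_fields U V" "Y \<in> vector_fields U V" for i X Y
    using that by (simp add: vector_fields_def D_def vec_eq_iff deriv_add distrib_right sum.distrib)
  moreover have "D i (a *s X) = deriv_nc U V i a *s X + a *s D i X"
    if "a \<in> smooth U V" "X \<in> vector_fields U V" for i a X
    using that by (simp add: vector_fields_def D_def vec_eq_iff deriv_mult distrib_left mult.assoc sum_distrib_left)
  moreover have "inner_nc (diag_metric potential) (D i (basis_field j)) (basis_field k) = christoffel i j k" for i j k
  proof -
    have "D i (basis_field j) $ k = C i j k"
      by (simp add: D_def basis_field_def axis_def deriv_one deriv_zero if_distrib[of "\<lambda>x. x * _"]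
          if_distrib[of "deriv_nc U V i"] cong: if_cong)
    then show ?thesis
      by (simp add: inner_nc_diag_metric_basis C_def mult.assoc exp_potential_inverse)
  qed
  ultimately show "levi_civita U V (diag_metric potential) D"
    by (simp add: levi_civita_def christoffel_def)
qed

text \<open>
  The only nonzero components on basis fields are \<open>\<nabla>\<^sub>1\<partial>\<^sub>1 = a \<partial>\<^sub>2\<close> and \<open>\<nabla>\<^sub>1\<partial>\<^sub>2 = \<nabla>\<^sub>2\<partial>\<^sub>1 = c \<partial>\<^sub>1\<close>, and \<open>f\<close>, its
  derivative and the exponentials all commute, as they lie in the algebra generated by \<open>V\<close>. The two
  summands of the curvature turn out equal. The second derivative of \<open>f\<close> is \<open>f\<close> itself.
\<close>

lemma scalar_curvature_potential:
  assumes D: "levi_civita U V (diag_metric potential) D"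
  shows "scalar_curvature potential D = - potential - (1/2) *\<^sub>R potential'\<^sup>2"
proof -
  let ?h = potential' and ?E = "exp potential"
  define a where "a = - (1/2) *\<^sub>R (?h * ?E)"
  define c where "c = (1/2) *\<^sub>R ?h"
  note [simp] = basis_in_vector_fields
  have smooth: "a \<in> smooth U V" "c \<in> smooth U V"
    by (simp_all add: a_def c_def smooth_scaleR smooth_mult smooth_potential smooth_exp_potential_1 smooth_minus)
  have add: "D i (X + Y) = D i X + D i Y" if "X \<in> vector_fields U V" "Y \<in> vector_fields U V" for i X Y
    using D that by (simp add: levi_civita_def)
  have leibniz: "D i (b *s basis_field j) = deriv_nc U V i b *s basis_field j + b *s D i (basis_field j)"
    if "b \<in> smooth U V" for i j b
    using D that by (simp add: levi_civita_def)
  have metric: "D i (basis_field j) $ k * (if k = 1 then ?E else 1) = christoffel i j k" for i j k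
    using D by (simp add: levi_civita_def christoffel_def flip: inner_nc_diag_metric_basis)
  have comp1: "D i (basis_field j) $ 1 = christoffel i j 1 * exp (- potential)" for i j
    using arg_cong[OF metric[of i j 1], of "\<lambda>x. x * exp (- potential)"]
    by (simp add: mult.assoc exp_potential_inverse)
  have comp2: "D i (basis_field j) $ 2 = christoffel i j 2" for i j
    using metric[of i j 2] by simp
  have basis: "basis_field 1 $ 1 = (1::'a)" "basis_field 1 $ 2 = (0::'a)"
    "basis_field 2 $ 1 = (0::'a)" "basis_field 2 $ 2 = (1::'a)"
    by (simp_all add: basis_field_def axis_def)
  have D11: "D 1 (basis_field 1) = a *s basis_field 2"
    by (simp add: vec_eq_iff forall_2 comp1 comp2 christoffel_simps basis a_def)
  have D12: "D 1 (basis_field 2) = c *s basis_field 1"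
    by (simp add: vec_eq_iff forall_2 comp1 comp2 christoffel_simps basis c_def mult.assoc exp_potential_inverse)
  have D21: "D 2 (basis_field 1) = c *s basis_field 1"
    by (simp add: vec_eq_iff forall_2 comp1 comp2 christoffel_simps basis c_def mult.assoc exp_potential_inverse)
  have D22: "D 2 (basis_field 2) = 0"
    by (simp add: vec_eq_iff forall_2 comp1 comp2 christoffel_simps)
  have D0: "D i 0 = 0" for i
    using add[of 0 0 i] by (simp add: vector_fields_def smooth_zero)
  have comm: "?h * (?E * x) = ?E * (?h * x)" "potential * (?E * x) = ?E * (potential * x)" "?h * ?E = ?E * ?h" "potential * ?E = ?E * potential" for x
    by (auto intro!: commute_left commute_exp potential_commute)
  have deriv_a: "deriv_nc U V 2 a = - (1/2) *\<^sub>R (potential * ?E + ?h * (?h * ?E))"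
    by (simp add: a_def deriv_scaleR deriv_minus smooth_scaleR smooth_mult smooth_potential smooth_exp_potential_1
        deriv_mult deriv_potential deriv_exp_potential_1)
  have deriv_c: "deriv_nc U V 1 c = 0" "deriv_nc U V 2 c = (1/2) *\<^sub>R potential"
    by (simp_all add: c_def deriv_scaleR smooth_potential deriv_potential)
  have R1212: "riemann (diag_metric potential) D 1 2 1 2 = deriv_nc U V 2 a - c * a"
    by (simp add: riemann_def inner_nc_diag_metric_basis D11 D21 D22 leibniz smooth deriv_c basis)
  have R2121: "riemann (diag_metric potential) D 2 1 2 1 = - (deriv_nc U V 2 c + c * c) * ?E"
    by (simp add: riemann_def inner_nc_diag_metric_basis D12 D21 D22 D0 leibniz smooth basis)
  have "riemann (diag_metric potential) D 1 2 1 2 + riemann (diag_metric potential) D 2 1 2 1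
      = ?E * (- potential - (1/2) *\<^sub>R (?h * ?h))"
    unfolding R1212 R2121 deriv_a deriv_c
    by (simp add: a_def c_def comm algebra_simps flip: scaleR_add_left)
  then show ?thesis
    by (simp add: scalar_curvature_def power2_eq_square exp_potential_inverse flip: mult.assoc)
qed

text \<open>
  Gauss--Bonnet: \<open>R e\<^bsup>f/2\<^esup>\<close> is the total derivative \<open>- \<partial>\<^sub>2 (\<partial>\<^sub>2 f e\<^bsup>f/2\<^esup>)\<close>.
\<close>

lemma trace_curvature_zero:
  "nc_trace U V ((- potential - (1/2) *\<^sub>R potential'\<^sup>2) * exp ((1/2) *\<^sub>R potential)) = 0"
proof -
  let ?G = "exp ((1/2) *\<^sub>R potential)"
  have "deriv_nc U V 2 (potential' * ?G) = potential * ?G + potential' * ((1/2) *\<^sub>R (potential' * ?G))"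
    by (simp add: deriv_mult smooth_potential smooth_exp_potential deriv_potential deriv_exp_potential)
  then have "deriv_nc U V 2 (- (potential' * ?G)) = (- potential - (1/2) *\<^sub>R potential'\<^sup>2) * ?G"
    by (simp add: deriv_minus smooth_mult smooth_potential smooth_exp_potential power2_eq_square algebra_simps)
  moreover have "nc_trace U V (deriv_nc U V 2 (- (potential' * ?G))) = 0"
    by (intro trace_deriv smooth_minus smooth_mult smooth_potential smooth_exp_potential)
  ultimately show ?thesis by simp
qed

end

theorem proposition4p2:
  fixes \<theta> :: real and U V f :: "'a::cstar_algebra"
  assumes torus: "noncommutative_torus \<theta> U V"
    and f: "f = 2 * (V + upow V (- 1))"
  shows "(\<exists>D. levi_civita U V (diag_metric f) D) \<and>
    (\<forall>D. levi_civita U V (diag_metric f) D \<longrightarrow>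
       (let R = scalar_curvature f D in
          R = - deriv_nc U V 2 (deriv_nc U V 2 f) - (1/2) *\<^sub>R (deriv_nc U V 2 f)\<^sup>2 \<and>
          nc_trace U V (R * cstar_sqrt (det_nc (diag_metric f))) = nc_trace U V (R * exp ((1/2) *\<^sub>R f)) \<and>
          nc_trace U V (R * exp ((1/2) *\<^sub>R f)) = 0))"
proof -
  interpret nc_torus \<theta> U V by (rule nc_torus.intro[OF torus])
  have f': "f = potential"
    by (simp add: f potential_def scaleR_2 mult_2)
  have "det_nc (diag_metric f) = exp f"
    by (simp add: det_nc_def diag_metric_def)
  then have sqrt: "cstar_sqrt (det_nc (diag_metric f)) = exp ((1/2) *\<^sub>R f)"
    by (simp add: cstar_sqrt_exp f' adj_potential)
  show ?thesis
    unfolding sqrt unfolding f' 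
    by (simp add: Let_def ex_levi_civita scalar_curvature_potential deriv_potential trace_curvature_zero)
qed

end
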